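(* Let $g:\Gamma\to\Gamma$ be a train track representative of a fully irreducible outer automorphism $\phi\in\mathrm{Out}(F_r)$. Then the lamination train track (LTT) structure $G(g)$ is birecurrent.
   Context: $F_r$ is the free group of rank $r$. An element $\phi\in\mathrm{Out}(F_r)$ is reducible if there are nontrivial proper free factors $F^1,\dots,F^k$ of $F_r$ whose conjugacy classes are permuted by $\phi$ and such that $F^1*\cdots*F^k$ is a free factor of $F_r$; otherwise irreducible; fully irreducible if every positive power is irreducible. A marked graph is a finite connected graph $\Gamma$ without valence-one vertices together with a homotopy equivalence $R_r\to\Gamma$ from the $r$-petaled rose. A train track representative of $\phi$ is a homotopy equivalence $g:\Gamma\to\Gamma$ of a marked graph inducing $\phi$ on fundamental groups, mapping vertices to vertices, such that every $g^k$, $k>0$, is locally injective on edge interiors. Directions at a vertex are germs of initial segments of oriented edges emanating from it; $D_0(e)$ is the initial direction of the oriented edge $e$; $\bar e$ is $e$ reversed; $Dg(D_0(e))=D_0(g(e))$; a direction $d$ is periodic if $Dg^k(d)=d$ for some $k>0$. An edge path $\cdots e e'\cdots$ takes the turn $\{D_0(\bar e),D_0(e')\}$. The LTT structure $G(g)$ is the following graph. It has one vertex for each direction at each vertex of $\Gamma$. It has a colored edge joining $d_1$ and $d_2$ (directions at a common vertex) whenever the turn $\{d_1,d_2\}$ is taken by $g^k(e)$ for some $k>0$ and some edge $e$ of $\Gamma$ (so the colored edges over a vertex $v$ form the local Whitehead graph $LW(g;v)$); vertices for periodic directions are purple, other vertices are red; a colored edge is purple if both its endpoints are purple and red otherwise.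 For each unoriented edge $e$ of $\Gamma$ there is one black edge joining $D_0(e)$ and $D_0(\bar e)$. A path or line in $G(g)$ is smooth if it alternates between colored and black edges. $G(g)$ is birecurrent if there is a locally smoothly embedded line $\mathbf{R}\to G(g)$ (i.e. a bi-infinite smooth path) that crosses each edge of $G(g)$ infinitely many times in each of its two ends (as the parameter tends to $+\infty$ and as it tends to $-\infty$).
   Formalization: The rank r is assumed to be at least 2; for r = 1 the claim fails, since every class in Out(F_1) is vacuously fully irreducible while the identity of a circle takes no turns, so G(g) carries no smooth line, and for r = 0 G(g) is empty. *)

theory Defs
  imports "Graph_Theory.Bidirected_Digraph" "Graph_Theory.Digraph_Component"
    "Graph_Theory.Arc_Walk" "HOL-Algebra.Bij" "HOL-Algebra.Generated_Groups"
begin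

section \<open>Free groups\<close>

text \<open>
  Words without subwords of the form \<open>x, iv x\<close>, where \<open>iv\<close> is an involution. The letters
  are either signed generators of a free group or oriented edges of a graph.
\<close>

definition reduced :: "('a \<Rightarrow> 'a) \<Rightarrow> 'a list \<Rightarrow> bool" where
  "reduced iv w \<longleftrightarrow> successively (\<lambda>x y. y \<noteq> iv x) w"

definition cancel_cons :: "('a \<Rightarrow> 'a) \<Rightarrow> 'a \<Rightarrow> 'a list \<Rightarrow> 'a list" where
  "cancel_cons iv x w = (case w of [] \<Rightarrow> [x] | y # v \<Rightarrow> if y = iv x then v else x # w)"

definition reduce :: "('a \<Rightarrow> 'a) \<Rightarrow> 'a list \<Rightarrow> 'a list" where
  "reduce iv w = foldr (cancel_cons iv) w []"

text \<open>\<open>(i, True)\<close> stands for the \<open>i\<close>-th generator and \<open>(i, False)\<close> for its inverse.\<close>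

type_synonym letter = "nat \<times> bool"

definition letters :: "nat \<Rightarrow> letter set" where
  "letters r = {..<r} \<times> UNIV"

definition letter_inv :: "letter \<Rightarrow> letter" where
  "letter_inv x = (fst x, \<not> snd x)"

definition free_group :: "nat \<Rightarrow> letter list monoid" where
  "free_group r =
    \<lparr>carrier = {w. set w \<subseteq> letters r \<and> reduced letter_inv w},
     monoid.mult = (\<lambda>u v. reduce letter_inv (u @ v)),
     one = []\<rparr>"

lemma letter_inv_inv [simp]: "letter_inv (letter_inv x) = x"
  by (simp add: letter_inv_def)

lemma letter_inv_letters [simp]: "letter_inv x \<in> letters r \<longleftrightarrow> x \<in> letters r"
  by (auto simp: letter_inv_def letters_def mem_Times_iff)

context
  fixes iv :: "'a \<Rightarrow> 'a"
  assumes iv_iv: "iv (iv x) = x"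
begin

lemma reduced_cancel_cons: "reduced iv w \<Longrightarrow> reduced iv (cancel_cons iv x w)"
  by (cases w) (auto simp: reduced_def cancel_cons_def successively_Cons)

lemma reduced_foldr: "reduced iv w \<Longrightarrow> reduced iv (foldr (cancel_cons iv) u w)"
  by (induction u) (auto intro: reduced_cancel_cons)

lemma cancel_cons_inv: "reduced iv w \<Longrightarrow> cancel_cons iv x (cancel_cons iv (iv x) w) = w"
  by (cases w)
    (auto simp: reduced_def cancel_cons_def successively_Cons iv_iv split: list.splits)

lemma foldr_cancel_cons:
  assumes "reduced iv w"
  shows "foldr (cancel_cons iv) (cancel_cons iv x u) w = cancel_cons iv x (foldr (cancel_cons iv) u w)"
  using cancel_cons_inv[OF reduced_foldr[OF assms], of x]
  by (auto simp: cancel_cons_def[of iv x u] split: list.splits)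

lemma foldr_reduce:
  "reduced iv w \<Longrightarrow> foldr (cancel_cons iv) (reduce iv u) w = foldr (cancel_cons iv) u w"
  by (induction u) (auto simp: reduce_def foldr_cancel_cons)

lemma reduce_append: "reduce iv (u @ v) = foldr (cancel_cons iv) u (reduce iv v)"
  by (simp add: reduce_def)

lemma reduced_reduce: "reduced iv (reduce iv w)"
  unfolding reduce_def by (rule reduced_foldr) (simp add: reduced_def)

lemma reduce_id: "reduced iv w \<Longrightarrow> reduce iv w = w"
  by (induction w)
    (auto simp: reduce_def reduced_def cancel_cons_def successively_Cons split: list.splits)

lemma reduce_assoc: "reduce iv (reduce iv (u @ v) @ w) = reduce iv (u @ reduce iv (v @ w))"
  by (metis append.assoc foldr_reduce reduce_append reduce_id reduced_reduce)

lemma reduced_rev_map: "reduced iv w \<Longrightarrow> reduced iv (rev (map iv w))"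
proof -
  have "(iv a \<noteq> iv (iv b)) = (b \<noteq> iv a)" for a b
    by (metis iv_iv)
  then show "reduced iv w \<Longrightarrow> reduced iv (rev (map iv w))"
    by (simp add: reduced_def successively_rev successively_map)
qed

lemma foldr_rev_map:
  "reduced iv v \<Longrightarrow> foldr (cancel_cons iv) (rev (map iv w)) (foldr (cancel_cons iv) w v) = v"
proof (induction w)
  case (Cons a w)
  have "cancel_cons iv (iv a) (cancel_cons iv a (foldr (cancel_cons iv) w v)) =
      foldr (cancel_cons iv) w v"
    using cancel_cons_inv[OF reduced_foldr[OF Cons.prems], of "iv a"] by (simp add: iv_iv)
  with Cons show ?case by simp
qed simp

lemma reduce_rev_map: "reduce iv (rev (map iv w) @ w) = []"
  unfolding reduce_append using foldr_rev_map[of "[]" w]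
  by (simp add: reduce_def reduced_def)

lemma set_reduce: "set (reduce iv w) \<subseteq> set w"
proof (induction w)
  case (Cons a w)
  have "set (cancel_cons iv a u) \<subseteq> insert a (set u)" for u
    by (auto simp: cancel_cons_def split: list.splits if_splits)
  with Cons show ?case by (fastforce simp: reduce_def)
qed (simp add: reduce_def)

end

lemma group_free_group: "group (free_group r)"
proof (rule groupI)
  note [simp] = free_group_def
  fix x y z
  show "x \<otimes>\<^bsub>free_group r\<^esub> y \<in> carrier (free_group r)"
    if "x \<in> carrier (free_group r)" "y \<in> carrier (free_group r)"
    using that set_reduce[of letter_inv "x @ y"] by (auto simp: reduced_reduce)
  show "\<one>\<^bsub>free_group r\<^esub> \<in> carrier (free_group r)"
    by (simp add: reduced_def)
  show "x \<otimes>\<^bsub>free_group r\<^esub> y \<otimes>\<^bsub>free_group r\<^esub> z = x \<otimes>\<^bsub>free_group r\<^esub> (y \<otimes>\<^bsub>free_group r\<^esub> z)"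
    by (simp add: reduce_assoc)
  show "\<one>\<^bsub>free_group r\<^esub> \<otimes>\<^bsub>free_group r\<^esub> x = x" if "x \<in> carrier (free_group r)"
    using that by (simp add: reduce_id)
  show "\<exists>y\<in>carrier (free_group r). y \<otimes>\<^bsub>free_group r\<^esub> x = \<one>\<^bsub>free_group r\<^esub>"
    if "x \<in> carrier (free_group r)"
    using that
    by (intro bexI[of _ "rev (map letter_inv x)"]) (auto simp: reduce_rev_map reduced_rev_map)
qed


section \<open>Outer automorphisms and irreducibility\<close>

definition Inn :: "('a, 'b) monoid_scheme \<Rightarrow> ('a \<Rightarrow> 'a) set" where
  "Inn G = {\<lambda>x\<in>carrier G. a \<otimes>\<^bsub>G\<^esub> x \<otimes>\<^bsub>G\<^esub> inv\<^bsub>G\<^esub> a | a. a \<in> carrier G}"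

text \<open>The elements of \<open>Out G\<close> are cosets, i.e. sets of automorphisms of \<open>G\<close>.\<close>

definition Out :: "('a, 'b) monoid_scheme \<Rightarrow> ('a \<Rightarrow> 'a) set monoid" where
  "Out G = AutoGroup G Mod Inn G"

lemma (in group) normal_Inn: "Inn G \<lhd> AutoGroup G"
proof -
  let ?c = "\<lambda>a. \<lambda>x\<in>carrier G. a \<otimes> x \<otimes> inv a"
  interpret A: group "AutoGroup G" by (rule AutoGroup)
  have mult: "f \<otimes>\<^bsub>AutoGroup G\<^esub> h = compose (carrier G) f h" if "f \<in> auto G" "h \<in> auto G" for f h
    using that by (simp add: AutoGroup_def BijGroup_def auto_def)
  have one: "\<one>\<^bsub>AutoGroup G\<^esub> = (\<lambda>x\<in>carrier G. x)"
    by (simp add: AutoGroup_def BijGroup_def)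
  have carrier: "carrier (AutoGroup G) = auto G"
    by (simp add: AutoGroup_def)
  have cancel: "inv a \<otimes> (a \<otimes> x) = x" "a \<otimes> (inv a \<otimes> x) = x"
    if "a \<in> carrier G" "x \<in> carrier G" for a x
    using that by (simp_all add: m_assoc[symmetric])
  have auto: "?c a \<in> auto G" if a: "a \<in> carrier G" for a
  proof -
    have "bij_betw (?c a) (carrier G) (carrier G)"
      by (rule bij_betw_byWitness[where f' = "\<lambda>x. inv a \<otimes> x \<otimes> a"])
        (use a in \<open>auto simp: m_assoc cancel\<close>)
    then show ?thesis
      using a by (auto simp: auto_def Bij_def hom_def m_assoc cancel)
  qed
  have comp: "?c a \<otimes>\<^bsub>AutoGroup G\<^esub> ?c b = ?c (a \<otimes> b)" if "a \<in> carrier G" "b \<in> carrier G" for a b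
    unfolding mult[OF auto[OF that(1)] auto[OF that(2)]]
    using that by (auto simp: compose_def inv_mult_group m_assoc fun_eq_iff)
  have c_one: "?c \<one> = \<one>\<^bsub>AutoGroup G\<^esub>"
    by (auto simp: one fun_eq_iff restrict_def)
  have c_inv: "inv\<^bsub>AutoGroup G\<^esub> ?c a = ?c (inv a)" if "a \<in> carrier G" for a
  proof (rule A.inv_equality)
    show "?c (inv a) \<otimes>\<^bsub>AutoGroup G\<^esub> ?c a = \<one>\<^bsub>AutoGroup G\<^esub>"
      unfolding comp[OF inv_closed[OF that] that] l_inv[OF that] by (rule c_one)
  qed (unfold carrier, (rule auto, simp add: that)+)
  have "subgroup (Inn G) (AutoGroup G)"
  proof
    show "Inn G \<subseteq> carrier (AutoGroup G)"
      using auto by (auto simp: Inn_def carrier)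
    show "\<one>\<^bsub>AutoGroup G\<^esub> \<in> Inn G"
      unfolding Inn_def using c_one[symmetric] one_closed by blast
    show "f \<otimes>\<^bsub>AutoGroup G\<^esub> h \<in> Inn G" if "f \<in> Inn G" "h \<in> Inn G" for f h
      using that comp m_closed unfolding Inn_def by blast
    show "inv\<^bsub>AutoGroup G\<^esub> f \<in> Inn G" if "f \<in> Inn G" for f
      using that c_inv inv_closed unfolding Inn_def by blast
  qed
  moreover have "f \<otimes>\<^bsub>AutoGroup G\<^esub> h \<otimes>\<^bsub>AutoGroup G\<^esub> inv\<^bsub>AutoGroup G\<^esub> f \<in> Inn G"
    if f: "f \<in> carrier (AutoGroup G)" and h: "h \<in> Inn G" for f h
  proof -
    from h obtain a where a: "a \<in> carrier G" "h = ?c a"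
      by (auto simp: Inn_def)
    have f': "f \<in> auto G" "f \<in> hom G G"
      using f by (auto simp: carrier auto_def)
    have fa: "f a \<in> carrier G"
      using a f' by (auto simp: hom_def)
    have "f (inv a) = inv (f a)"
      using a f' by (intro group_hom.hom_inv group_hom.intro group_hom_axioms.intro)
        (auto intro: group_axioms)
    then have "f \<otimes>\<^bsub>AutoGroup G\<^esub> ?c a = ?c (f a) \<otimes>\<^bsub>AutoGroup G\<^esub> f"
      unfolding mult[OF f'(1) auto[OF a(1)]] mult[OF auto[OF fa] f'(1)]
      using a f' fa by (auto simp: compose_def hom_def fun_eq_iff Pi_iff)
    then have "f \<otimes>\<^bsub>AutoGroup G\<^esub> h \<otimes>\<^bsub>AutoGroup G\<^esub> inv\<^bsub>AutoGroup G\<^esub> f = ?c (f a)"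
      using A.m_assoc[of "?c (f a)" f "inv\<^bsub>AutoGroup G\<^esub> f"] A.r_inv[of f]
        A.r_one[of "?c (f a)"] A.inv_closed[of f] auto[OF fa] a(2) f
      unfolding carrier by metis
    then show ?thesis
      using fa by (auto simp: Inn_def)
  qed
  ultimately show ?thesis
    by (auto simp: A.normal_inv_iff)
qed

text \<open>
  The subgroup \<open>K\<close> is the internal free product of the subgroups \<open>H i\<close>: they generate \<open>K\<close>, and
  no nonempty product of nontrivial elements in which neighbouring factors come
  from different \<open>H i\<close> is trivial.
\<close>

definition is_free_product ::
    "('a, 'b) monoid_scheme \<Rightarrow> 'i set \<Rightarrow> ('i \<Rightarrow> 'a set) \<Rightarrow> 'a set \<Rightarrow> bool" where
  "is_free_product G I H K \<longleftrightarrow>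
    (\<forall>i\<in>I. subgroup (H i) G) \<and>
    generate G (\<Union>i\<in>I. H i) = K \<and>
    (\<forall>w. w \<noteq> [] \<longrightarrow> (\<forall>(i, h)\<in>set w. i \<in> I \<and> h \<in> H i \<and> h \<noteq> \<one>\<^bsub>G\<^esub>) \<longrightarrow>
      successively (\<lambda>x y. fst x \<noteq> fst y) w \<longrightarrow>
      foldr (\<otimes>\<^bsub>G\<^esub>) (map snd w) \<one>\<^bsub>G\<^esub> \<noteq> \<one>\<^bsub>G\<^esub>)"

definition free_factor :: "('a, 'b) monoid_scheme \<Rightarrow> 'a set \<Rightarrow> bool" where
  "free_factor G A \<longleftrightarrow>
    (\<exists>B. is_free_product G (UNIV :: bool set) (\<lambda>b. if b then A else B) (carrier G))"

definition conj_class :: "('a, 'b) monoid_scheme \<Rightarrow> 'a set \<Rightarrow> 'a set set" where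
  "conj_class G H = {(\<lambda>h. a \<otimes>\<^bsub>G\<^esub> h \<otimes>\<^bsub>G\<^esub> inv\<^bsub>G\<^esub> a) ` H | a. a \<in> carrier G}"

text \<open>The action of an outer automorphism on conjugacy classes of subgroups.\<close>

definition out_image :: "('a \<Rightarrow> 'a) set \<Rightarrow> 'a set set \<Rightarrow> 'a set set" where
  "out_image \<phi> C = {\<Phi> ` K | \<Phi> K. \<Phi> \<in> \<phi> \<and> K \<in> C}"

definition reducible :: "('a, 'b) monoid_scheme \<Rightarrow> ('a \<Rightarrow> 'a) set \<Rightarrow> bool" where
  "reducible G \<phi> \<longleftrightarrow>
    (\<exists>(k::nat) F.
      k \<ge> 1 \<and>
      (\<forall>i<k. free_factor G (F i) \<and> F i \<noteq> {\<one>\<^bsub>G\<^esub>} \<and> F i \<noteq> carrier G) \<and>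
      bij_betw (out_image \<phi>) ((\<lambda>i. conj_class G (F i)) ` {..<k}) ((\<lambda>i. conj_class G (F i)) ` {..<k}) \<and>
      (\<exists>K. is_free_product G {..<k} F K \<and> free_factor G K))"

definition irreducible_out :: "('a, 'b) monoid_scheme \<Rightarrow> ('a \<Rightarrow> 'a) set \<Rightarrow> bool" where
  "irreducible_out G \<phi> \<longleftrightarrow> \<not> reducible G \<phi>"

definition fully_irreducible :: "('a, 'b) monoid_scheme \<Rightarrow> ('a \<Rightarrow> 'a) set \<Rightarrow> bool" where
  "fully_irreducible G \<phi> \<longleftrightarrow> (\<forall>k::nat. k > 0 \<longrightarrow> irreducible_out G (\<phi> [^]\<^bsub>Out G\<^esub> k))"


section \<open>Graphs, edge paths and homotopy\<close>

text \<open>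
  A graph is a bidirected digraph: its arcs are the oriented edges, and \<open>rv\<close> is the
  orientation-reversing involution, so that an unoriented edge is a pair \<open>{e, rv e}\<close>. Loops
  and multiple edges are allowed. Edge paths are the arc walks of the digraph. A map
  sending vertices to vertices is represented by the edge path, possibly constant or with
  backtracking, that the image of each oriented edge traverses. A map that is locally injective
  on edge interiors is of this form up to reparametrisation; a general map is so up to homotopy
  relative to the vertices.
\<close>

abbreviation edge_path :: "('v, 'e) pre_digraph \<Rightarrow> 'v \<Rightarrow> 'e list \<Rightarrow> 'v \<Rightarrow> bool" where
  "edge_path \<Gamma> \<equiv> pre_digraph.awalk \<Gamma>"

definition path_inv :: "('e \<Rightarrow> 'e) \<Rightarrow> 'e list \<Rightarrow> 'e list" where
  "path_inv rv p = rev (map rv p)"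

text \<open>Homotopy of edge paths relative to their endpoints.\<close>

inductive path_homotopic ::
    "('v, 'e) pre_digraph \<Rightarrow> ('e \<Rightarrow> 'e) \<Rightarrow> 'e list \<Rightarrow> 'e list \<Rightarrow> bool"
  for \<Gamma> :: "('v, 'e) pre_digraph" and rv :: "'e \<Rightarrow> 'e" where
  backtrack: "edge_path \<Gamma> u (p @ [e, rv e] @ q) v \<Longrightarrow>
    path_homotopic \<Gamma> rv (p @ [e, rv e] @ q) (p @ q)"
| refl: "path_homotopic \<Gamma> rv p p"
| sym: "path_homotopic \<Gamma> rv p q \<Longrightarrow> path_homotopic \<Gamma> rv q p"
| trans: "path_homotopic \<Gamma> rv p q \<Longrightarrow> path_homotopic \<Gamma> rv q s \<Longrightarrow> path_homotopic \<Gamma> rv p s"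

record ('v, 'e, 'w, 'f) graph_map =
  vmap :: "'v \<Rightarrow> 'w"
  emap :: "'e \<Rightarrow> 'f list"

definition path_map :: "('v, 'e, 'w, 'f) graph_map \<Rightarrow> 'e list \<Rightarrow> 'f list" where
  "path_map f p = concat (map (emap f) p)"

definition is_graph_map :: "('v, 'e) pre_digraph \<Rightarrow> ('e \<Rightarrow> 'e) \<Rightarrow>
    ('w, 'f) pre_digraph \<Rightarrow> ('f \<Rightarrow> 'f) \<Rightarrow> ('v, 'e, 'w, 'f) graph_map \<Rightarrow> bool" where
  "is_graph_map \<Gamma> rv \<Delta> rv' f \<longleftrightarrow>
    (\<forall>v\<in>verts \<Gamma>. vmap f v \<in> verts \<Delta>) \<and>
    (\<forall>e\<in>arcs \<Gamma>. edge_path \<Delta> (vmap f (tail \<Gamma> e)) (emap f e) (vmap f (head \<Gamma> e)) \<and>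
      emap f (rv e) = path_inv rv' (emap f e))"

definition id_map :: "('v, 'e, 'v, 'e) graph_map" where
  "id_map = \<lparr>vmap = (\<lambda>v. v), emap = (\<lambda>e. [e])\<rparr>"

definition comp_map ::
    "('w, 'f, 'x, 'h) graph_map \<Rightarrow> ('v, 'e, 'w, 'f) graph_map \<Rightarrow> ('v, 'e, 'x, 'h) graph_map" where
  "comp_map h f = \<lparr>vmap = vmap h \<circ> vmap f, emap = path_map h \<circ> emap f\<rparr>"

text \<open>
  A free homotopy from \<open>f\<close> to \<open>h\<close>: the path \<open>P v\<close> is the track of the vertex \<open>v\<close>, and each
  edge \<open>e\<close> gives a square with sides \<open>f e\<close>, \<open>h e\<close> and the tracks of its endpoints.
\<close>

definition map_homotopic :: "('v, 'e) pre_digraph \<Rightarrow> ('w, 'f) pre_digraph \<Rightarrow> ('f \<Rightarrow> 'f) \<Rightarrow>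
    ('v, 'e, 'w, 'f) graph_map \<Rightarrow> ('v, 'e, 'w, 'f) graph_map \<Rightarrow> bool" where
  "map_homotopic \<Gamma> \<Delta> rv' f h \<longleftrightarrow>
    (\<exists>P. (\<forall>v\<in>verts \<Gamma>. edge_path \<Delta> (vmap f v) (P v) (vmap h v)) \<and>
      (\<forall>e\<in>arcs \<Gamma>.
        path_homotopic \<Delta> rv' (emap f e @ P (head \<Gamma> e)) (P (tail \<Gamma> e) @ emap h e)))"

definition homotopy_equiv :: "('v, 'e) pre_digraph \<Rightarrow> ('e \<Rightarrow> 'e) \<Rightarrow>
    ('w, 'f) pre_digraph \<Rightarrow> ('f \<Rightarrow> 'f) \<Rightarrow> ('v, 'e, 'w, 'f) graph_map \<Rightarrow> bool" where
  "homotopy_equiv \<Gamma> rv \<Delta> rv' f \<longleftrightarrow>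
    is_graph_map \<Gamma> rv \<Delta> rv' f \<and>
    (\<exists>h. is_graph_map \<Delta> rv' \<Gamma> rv h \<and>
      map_homotopic \<Gamma> \<Gamma> rv (comp_map h f) id_map \<and>
      map_homotopic \<Delta> \<Delta> rv' (comp_map f h) id_map)"


section \<open>Marked graphs and train track representatives\<close>

text \<open>
  The reduced edge loops of the rose with \<open>r\<close> petals are the elements of \<open>free_group r\<close>.
  The reversal has to fix everything that is not an arc, as \<open>bidirected_digraph\<close> demands.
\<close>

definition rose :: "nat \<Rightarrow> (unit, letter) pre_digraph" where
  "rose r = \<lparr>verts = {()}, arcs = letters r, tail = (\<lambda>_. ()), head = (\<lambda>_. ())\<rparr>"

definition rose_rev :: "nat \<Rightarrow> letter \<Rightarrow> letter" where
  "rose_rev r x = (if x \<in> letters r then letter_inv x else x)"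

lemma bidirected_digraph_rose: "bidirected_digraph (rose r) (rose_rev r)"
  by unfold_locales (auto simp: rose_def rose_rev_def letter_inv_def letters_def prod_eq_iff)

definition marked_graph :: "nat \<Rightarrow> ('v, 'e) pre_digraph \<Rightarrow> ('e \<Rightarrow> 'e) \<Rightarrow>
    (unit, letter, 'v, 'e) graph_map \<Rightarrow> bool" where
  "marked_graph r \<Gamma> rv m \<longleftrightarrow>
    fin_digraph \<Gamma> \<and> bidirected_digraph \<Gamma> rv \<and> connected \<Gamma> \<and>
    (\<forall>v\<in>verts \<Gamma>. out_degree \<Gamma> v \<noteq> 1) \<and>
    homotopy_equiv (rose r) (rose_rev r) \<Gamma> rv m"

text \<open>
  \<open>g\<close> induces \<open>\<phi>\<close> on fundamental groups: identifying \<open>free_group r\<close> with the fundamental group of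
  \<open>\<Gamma>\<close> by the marking \<open>m\<close>, and moving the base point along a path \<open>p\<close>, the map \<open>g\<close> acts as an
  automorphism in the class \<open>\<phi>\<close>.
\<close>

definition induces :: "nat \<Rightarrow> ('v, 'e) pre_digraph \<Rightarrow> ('e \<Rightarrow> 'e) \<Rightarrow>
    (unit, letter, 'v, 'e) graph_map \<Rightarrow> ('v, 'e, 'v, 'e) graph_map \<Rightarrow>
    (letter list \<Rightarrow> letter list) set \<Rightarrow> bool" where
  "induces r \<Gamma> rv m g \<phi> \<longleftrightarrow>
    (\<exists>\<Phi>\<in>\<phi>. \<exists>p. edge_path \<Gamma> (vmap m ()) p (vmap g (vmap m ())) \<and>
      (\<forall>w\<in>carrier (free_group r).
        path_homotopic \<Gamma> rv (path_map g (path_map m w)) (path_inv rv p @ path_map m (\<Phi> w) @ p)))"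

text \<open>
  For maps given by edge paths, the iterate \<open>g\<^sup>k\<close> is locally injective on the interior of \<open>e\<close> iff the
  (untightened) edge path \<open>g\<^sup>k(e)\<close> is not constant and does not backtrack.
\<close>

definition train_track_rep :: "nat \<Rightarrow> ('v, 'e) pre_digraph \<Rightarrow> ('e \<Rightarrow> 'e) \<Rightarrow>
    (unit, letter, 'v, 'e) graph_map \<Rightarrow> ('v, 'e, 'v, 'e) graph_map \<Rightarrow>
    (letter list \<Rightarrow> letter list) set \<Rightarrow> bool" where
  "train_track_rep r \<Gamma> rv m g \<phi> \<longleftrightarrow>
    homotopy_equiv \<Gamma> rv \<Gamma> rv g \<and>
    induces r \<Gamma> rv m g \<phi> \<and>
    (\<forall>k::nat. k > 0 \<longrightarrow> (\<forall>e\<in>arcs \<Gamma>.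
      (path_map g ^^ k) [e] \<noteq> [] \<and> reduced rv ((path_map g ^^ k) [e])))"


section \<open>LTT structures\<close>

text \<open>
  The direction \<open>D\<^sub>0(e)\<close> is represented by the oriented edge \<open>e\<close> itself, so the directions
  at \<open>v\<close> are the oriented edges with tail \<open>v\<close>.
\<close>

definition D :: "('v, 'e, 'v, 'e) graph_map \<Rightarrow> 'e \<Rightarrow> 'e" where
  "D g d = hd (emap g d)"

definition periodic_dir :: "('v, 'e, 'v, 'e) graph_map \<Rightarrow> 'e \<Rightarrow> bool" where
  "periodic_dir g d \<longleftrightarrow> (\<exists>k::nat. k > 0 \<and> (D g ^^ k) d = d)"

definition takes_turn :: "('e \<Rightarrow> 'e) \<Rightarrow> 'e list \<Rightarrow> 'e \<Rightarrow> 'e \<Rightarrow> bool" where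
  "takes_turn rv p d\<^sub>1 d\<^sub>2 \<longleftrightarrow>
    (\<exists>i. Suc i < length p \<and> {d\<^sub>1, d\<^sub>2} = {rv (p ! i), p ! Suc i})"

datatype colour = Black | Purple | Red

text \<open>
  An edge is a colour together with its set of endpoints. This loses nothing: two vertices
  are joined by at most one black and at most one coloured (purple or red) edge, possibly by one of each.
\<close>

record 'd ltt =
  ltt_verts :: "'d set"
  ltt_edges :: "(colour \<times> 'd set) set"
  vert_colour :: "'d \<Rightarrow> colour"

definition dir_colour :: "('v, 'e, 'v, 'e) graph_map \<Rightarrow> 'e \<Rightarrow> colour" where
  "dir_colour g d = (if periodic_dir g d then Purple else Red)"

definition turn_colour :: "('v, 'e, 'v, 'e) graph_map \<Rightarrow> 'e \<Rightarrow> 'e \<Rightarrow> colour" where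
  "turn_colour g d\<^sub>1 d\<^sub>2 =
    (if dir_colour g d\<^sub>1 = Purple \<and> dir_colour g d\<^sub>2 = Purple then Purple else Red)"

definition LTT :: "('v, 'e) pre_digraph \<Rightarrow> ('e \<Rightarrow> 'e) \<Rightarrow> ('v, 'e, 'v, 'e) graph_map \<Rightarrow> 'e ltt" where
  "LTT \<Gamma> rv g =
    \<lparr>ltt_verts = arcs \<Gamma>,
     ltt_edges =
       {(Black, {e, rv e}) | e. e \<in> arcs \<Gamma>} \<union>
       {(turn_colour g d\<^sub>1 d\<^sub>2, {d\<^sub>1, d\<^sub>2}) | d\<^sub>1 d\<^sub>2.
         d\<^sub>1 \<in> arcs \<Gamma> \<and> d\<^sub>2 \<in> arcs \<Gamma> \<and> tail \<Gamma> d\<^sub>1 = tail \<Gamma> d\<^sub>2 \<and>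
         (\<exists>k::nat. k > 0 \<and> (\<exists>e\<in>arcs \<Gamma>. takes_turn rv ((path_map g ^^ k) [e]) d\<^sub>1 d\<^sub>2))},
     vert_colour = dir_colour g\<rparr>"

text \<open>
  A line passes through the vertices \<open>x i\<close>, crossing the edge \<open>c i\<close> between \<open>x i\<close> and
  \<open>x (i + 1)\<close>; it is smooth if black and coloured edges alternate.
\<close>

definition smooth_line :: "'d ltt \<Rightarrow> (int \<Rightarrow> 'd) \<Rightarrow> (int \<Rightarrow> colour \<times> 'd set) \<Rightarrow> bool" where
  "smooth_line L x c \<longleftrightarrow>
    (\<forall>i. x i \<in> ltt_verts L \<and> c i \<in> ltt_edges L \<and> snd (c i) = {x i, x (i + 1)} \<and>
      (fst (c (i + 1)) = Black \<longleftrightarrow> fst (c i) \<noteq> Black))"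

definition birecurrent :: "'d ltt \<Rightarrow> bool" where
  "birecurrent L \<longleftrightarrow>
    (\<exists>x c. smooth_line L x c \<and>
      (\<forall>b\<in>ltt_edges L. infinite {i. i \<ge> 0 \<and> c i = b} \<and> infinite {i. i \<le> 0 \<and> c i = b}))"

end

theory Submission
  imports Defs "HOL-Algebra.Sym_Groups"
begin

text \<open>
  A smooth line need not be a leaf of the lamination, so a periodic line suffices: it is enough to find a cyclic word of oriented
  edges, all of whose cyclically consecutive turns are taken by images \<open>g\<^sup>k(e)\<close>, in which every edge and every
  taken turn occurs (\<open>birecurrent_of_cyclic_word\<close>). Such a word is obtained from an edge \<open>b\<close> whose images under the iterates
  of \<open>g\<close> have unbounded length. Some growing edge \<open>c\<close> is repeated, with the same orientation, in some \<open>g\<^sup>k(b) = \<dots> c q c \<dots>\<close>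
  (\<open>growing_repeats\<close>), so the cyclic word \<open>c q\<close> takes only turns of \<open>g\<^sup>k(b)\<close>, and its image under \<open>g\<^sup>M\<close> only turns
  of \<open>g\<^bsup>k+M\<^esup>(b)\<close>. For large \<open>M\<close> the path \<open>g\<^sup>M(c)\<close> crosses every edge and takes every taken turn
  (\<open>growing_covers\<close>, \<open>growing_covers_turns\<close>).

  These facts rest on one consequence of full irreducibility (\<open>invariant_subgraph_no_loop\<close>): a proper subgraph \<open>S\<close> that is
  invariant under an iterate \<open>g\<^sup>i\<close> is a forest, so that the lengths of reduced paths in it are bounded. To see this, suppose that \<open>S\<close> carries an
  essential loop. As \<open>g\<close> is injective on fundamental groups and there are finitely many vertices, some image of this
  loop is an essential loop at a vertex \<open>w\<close> that is fixed by a power \<open>g\<^sup>N\<close> preserving \<open>S\<close>. The loops at \<open>w\<close> in \<open>S\<close>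
  form a free factor \<open>A\<close> of the fundamental group, as is seen by collapsing a spanning tree adapted to the component of
  \<open>w\<close> in \<open>S\<close> (\<open>reducible_of_invariant_loops\<close>). It is nontrivial, and it is proper because there are no vertices of
  valence one (\<open>adapted_spanning_tree\<close>). An automorphism \<open>\<Psi>\<close> in the class \<open>\<phi>\<^sup>N\<close> maps \<open>A\<close> into itself.
  Free groups being residually finite, this implies that \<open>\<Psi>\<close> maps \<open>A\<close> onto itself
  (\<open>retract_invariant_imp_fixed\<close>). So \<open>\<phi>\<^sup>N\<close> is reducible, a contradiction.

  A growing edge exists since otherwise a power of \<open>\<phi>\<close> would be trivial, hence reducible (\<open>ex_growing\<close>).
\<close>

section \<open>Words up to cancellation\<close>

text \<open>
  Two words are homotopic if they have the same reduced form. For edge paths with common endpoints this is homotopy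
  relative to the endpoints; no condition on endpoints is built in.
\<close>

abbreviation homotopic :: "('a \<Rightarrow> 'a) \<Rightarrow> 'a list \<Rightarrow> 'a list \<Rightarrow> bool" where
  "homotopic iv p q \<equiv> reduce iv p = reduce iv q"

locale involution =
  fixes iv :: "'a \<Rightarrow> 'a"
  assumes iv_iv [simp]: "iv (iv x) = x"
begin

lemma reduce_append_reduce: "reduce iv (reduce iv p @ reduce iv q) = reduce iv (p @ q)"
  by (metis append_Nil2 iv_iv reduce_append reduce_id reduced_reduce foldr_reduce)

lemma homotopic_append:
  "homotopic iv p p' \<Longrightarrow> homotopic iv q q' \<Longrightarrow> homotopic iv (p @ q) (p' @ q')"
  by (metis reduce_append_reduce)

lemma path_inv_Nil [simp]: "path_inv iv [] = []"
  by (simp add: path_inv_def)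

lemma path_inv_path_inv [simp]: "path_inv iv (path_inv iv p) = p"
  by (simp add: path_inv_def rev_map comp_def)

lemma path_inv_append [simp]: "path_inv iv (p @ q) = path_inv iv q @ path_inv iv p"
  by (simp add: path_inv_def)

lemma set_path_inv: "set (path_inv iv p) = iv ` set p"
  by (simp add: path_inv_def)

lemma reduce_path_inv_left: "reduce iv (path_inv iv p @ p) = []"
  unfolding path_inv_def by (rule reduce_rev_map) simp

lemma reduce_path_inv_right: "reduce iv (p @ path_inv iv p) = []"
  using reduce_path_inv_left[of "path_inv iv p"] by simp

lemma reduce_Nil [simp]: "reduce iv [] = []"
  by (simp add: reduce_def)

lemma homotopic_cancel_inner:
  "homotopic iv (a @ path_inv iv p @ p @ b) (a @ b)" "homotopic iv (a @ p @ path_inv iv p @ b) (a @ b)"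
proof -
  have "homotopic iv ((path_inv iv p @ p) @ b) ([] @ b)" "homotopic iv ((p @ path_inv iv p) @ b) ([] @ b)"
    using reduce_path_inv_left reduce_path_inv_right reduce_Nil by (metis homotopic_append)+
  then show "homotopic iv (a @ path_inv iv p @ p @ b) (a @ b)" "homotopic iv (a @ p @ path_inv iv p @ b) (a @ b)"
    by (auto intro!: homotopic_append)
qed

lemma homotopic_cancel_left: "homotopic iv (p @ q) (p @ q') \<Longrightarrow> homotopic iv q q'"
  using homotopic_append[of "path_inv iv p" "path_inv iv p" "p @ q" "p @ q'"]
    homotopic_cancel_inner(1)[of "[]"] by simp

lemma homotopic_cancel_right: "homotopic iv (q @ p) (q' @ p) \<Longrightarrow> homotopic iv q q'"
  using homotopic_append[of "q @ p" "q' @ p" "path_inv iv p" "path_inv iv p"]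
    homotopic_cancel_inner(2)[of _ p "[]"] by simp

lemma homotopic_path_inv: 
  assumes "homotopic iv p q" shows "homotopic iv (path_inv iv p) (path_inv iv q)"
proof (rule homotopic_cancel_right)
  show "homotopic iv (path_inv iv p @ p) (path_inv iv q @ p)"
    using homotopic_append[of "path_inv iv q" "path_inv iv q" p q] assms
    by (simp add: reduce_path_inv_left)
qed

lemma homotopic_of_path_homotopic:
  "path_homotopic \<Gamma> iv p q \<Longrightarrow> homotopic iv p q"
proof (induction rule: path_homotopic.induct)
  case (backtrack u p e q v)
  then show ?case
    using homotopic_cancel_inner(2)[of p "[e]" q] by (simp add: path_inv_def)
qed auto

text \<open>A map of words that respects inverses respects homotopy.\<close>

lemma reduce_concat_map_reduce:
  assumes "involution iv'" "\<And>x. x \<in> set w \<Longrightarrow> f (iv x) = path_inv iv' (f x)"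
  shows "homotopic iv' (concat (map f (reduce iv w))) (concat (map f w))"
  using assms(2)
proof (induction w)
  case (Cons a w)
  interpret I: involution iv' by fact
  let ?r = "reduce iv w"
  have IH: "homotopic iv' (concat (map f ?r)) (concat (map f w))"
    using Cons by simp
  have 1: "homotopic iv' (concat (map f (cancel_cons iv a ?r))) (f a @ concat (map f ?r))"
    using Cons.prems[of a] I.homotopic_cancel_inner(2)[of "[]" "f a"]
    by (auto simp: cancel_cons_def split: list.splits)
  have 2: "homotopic iv' (f a @ concat (map f ?r)) (f a @ concat (map f w))"
    by (rule I.homotopic_append) (simp_all add: IH)
  show ?case
    using 1 2 by (simp add: reduce_def)
qed simp

lemma homotopic_concat_map:
  assumes "involution iv'" "homotopic iv v w"
    "\<And>x. x \<in> set v \<union> set w \<Longrightarrow> f (iv x) = path_inv iv' (f x)"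
  shows "homotopic iv' (concat (map f v)) (concat (map f w))"
  using reduce_concat_map_reduce[of iv' v f] reduce_concat_map_reduce[of iv' w f] assms by simp

lemma set_reduce_subset: "set (reduce iv w) \<subseteq> set w"
  by (rule set_reduce) simp

lemma homotopic_reduce [simp]: "reduce iv (reduce iv p) = reduce iv p"
  by (rule reduce_id) (auto intro: reduced_reduce)

lemma path_inv_reduce: "reduce iv (path_inv iv p) = path_inv iv (reduce iv p)"
proof -
  have "reduced iv (path_inv iv (reduce iv p))"
    unfolding path_inv_def by (intro reduced_rev_map reduced_reduce) simp_all
  then show ?thesis
    using homotopic_path_inv[of p "reduce iv p"] by (simp add: reduce_id)
qed

end

lemma involution_letter_inv: "involution letter_inv"
  by unfold_locales simp

section \<open>Free factors given by sets of letters\<close>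

text \<open>
  A free basis of \<open>G\<close> in signed form: \<open>X\<close> contains each basis element together with its inverse, and \<open>\<Theta>\<close> writes an
  element of \<open>G\<close> as a reduced word over \<open>X\<close>. The assumptions make \<open>\<Theta>\<close> an isomorphism onto the group of
  reduced words. A letter fixed by \<open>iv\<close>, which would be an element of order two, is not excluded.
\<close>

locale free_basis = group G + involution iv
  for G :: "('a, 'c) monoid_scheme" (structure) and iv :: "'e \<Rightarrow> 'e" +
  fixes X :: "'e set" and \<Theta> :: "'a \<Rightarrow> 'e list"
  assumes iv_X: "e \<in> X \<Longrightarrow> iv e \<in> X"
    and set_\<Theta>: "x \<in> carrier G \<Longrightarrow> set (\<Theta> x) \<subseteq> X"
    and reduced_\<Theta>: "x \<in> carrier G \<Longrightarrow> reduced iv (\<Theta> x)"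
    and \<Theta>_mult: "x \<in> carrier G \<Longrightarrow> y \<in> carrier G \<Longrightarrow> \<Theta> (x \<otimes> y) = reduce iv (\<Theta> x @ \<Theta> y)"
    and \<Theta>_inj: "x \<in> carrier G \<Longrightarrow> \<Theta> x = [] \<Longrightarrow> x = \<one>"
    and \<Theta>_letter: "e \<in> X \<Longrightarrow> \<exists>x\<in>carrier G. \<Theta> x = [e]"
begin

text \<open>
  The subgroup of the elements that are spelled by letters from \<open>Y\<close>. For \<open>Y \<subseteq> X\<close> closed under inversion it
  is generated by the elements that the letters of \<open>Y\<close> spell.
\<close>

definition span :: "'e set \<Rightarrow> 'a set" where
  "span Y = {x \<in> carrier G. set (\<Theta> x) \<subseteq> Y}"

lemma \<Theta>_one: "\<Theta> \<one> = []"
proof -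
  have "homotopic iv (\<Theta> \<one> @ \<Theta> \<one>) (\<Theta> \<one> @ [])"
    using \<Theta>_mult[of \<one> \<one>] reduced_\<Theta>[of \<one>] by (simp add: reduce_id)
  then have "homotopic iv (\<Theta> \<one>) []"
    by (rule homotopic_cancel_left)
  then show ?thesis
    using reduced_\<Theta>[of \<one>] by (simp add: reduce_id)
qed

lemma \<Theta>_inv: assumes "x \<in> carrier G" shows "\<Theta> (inv x) = path_inv iv (\<Theta> x)"
proof -
  have "homotopic iv (\<Theta> x @ \<Theta> (inv x)) (\<Theta> x @ path_inv iv (\<Theta> x))"
    using \<Theta>_mult[of x "inv x"] assms by (simp add: \<Theta>_one reduce_path_inv_right)
  then have "homotopic iv (\<Theta> (inv x)) (path_inv iv (\<Theta> x))"
    by (rule homotopic_cancel_left)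
  then show ?thesis
    using reduced_\<Theta> assms path_inv_reduce[of "\<Theta> x"] by (simp add: reduce_id)
qed

lemma \<Theta>_eq: assumes "x \<in> carrier G" "y \<in> carrier G" "\<Theta> x = \<Theta> y" shows "x = y"
proof -
  have "\<Theta> (x \<otimes> inv y) = []"
    using assms by (simp add: \<Theta>_mult \<Theta>_inv reduce_path_inv_right)
  then have "x \<otimes> inv y = \<one>"
    using assms \<Theta>_inj by simp
  then show ?thesis
    using assms by (metis inv_closed inv_equality inv_inv)
qed

lemma span_subgroup:
  assumes "\<And>x. x \<in> Y \<Longrightarrow> iv x \<in> Y" shows "subgroup (span Y) G"
proof
  show "x \<otimes> y \<in> span Y" if "x \<in> span Y" "y \<in> span Y" for x y
    using that set_reduce_subset[of "\<Theta> x @ \<Theta> y"] by (auto simp: span_def \<Theta>_mult)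
  show "inv x \<in> span Y" if "x \<in> span Y" for x
    using that assms by (auto simp: span_def \<Theta>_inv set_path_inv)
qed (auto simp: span_def \<Theta>_one)

lemma \<Theta>_surj:
  assumes "set w \<subseteq> X" "reduced iv w" shows "\<exists>x\<in>carrier G. \<Theta> x = w"
  using assms
proof (induction w)
  case Nil
  then show ?case using \<Theta>_one by auto
next
  case (Cons e w)
  have "reduced iv w" using Cons.prems by (auto simp: reduced_def successively_Cons)
  with Cons obtain x where "x \<in> carrier G" "\<Theta> x = w" by auto
  moreover obtain y where "y \<in> carrier G" "\<Theta> y = [e]"
    using \<Theta>_letter[of e] Cons.prems by auto
  ultimately have "\<Theta> (y \<otimes> x) = e # w" using Cons.prems by (simp add: \<Theta>_mult reduce_id)
  then show ?case
    using \<open>x \<in> carrier G\<close> \<open>y \<in> carrier G\<close> by (intro bexI[of _ "y \<otimes> x"]) auto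
qed

lemma span_generate:
  assumes "Y \<union> Z = X" shows "generate G (span Y \<union> span Z) = carrier G"
proof
  show "generate G (span Y \<union> span Z) \<subseteq> carrier G"
    by (intro generate_incl) (auto simp: span_def)
  have "x \<in> generate G (span Y \<union> span Z)" if "x \<in> carrier G" "\<Theta> x = w" for x w
    using that
  proof (induction w arbitrary: x)
    case Nil
    then show ?case using \<Theta>_inj by (auto intro: generate.one)
  next
    case (Cons e w)
    have "e \<in> X" "set w \<subseteq> X" "reduced iv w" "reduced iv (e # w)"
      using Cons.prems set_\<Theta>[of x] reduced_\<Theta>[of x] by (auto simp: reduced_def successively_Cons)
    then obtain y z where yz: "y \<in> carrier G" "\<Theta> y = w" "z \<in> carrier G" "\<Theta> z = [e]"
      using \<Theta>_letter[of e] \<Theta>_surj[of w] by blast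
    then have "x = z \<otimes> y"
      using Cons.prems \<open>reduced iv (e # w)\<close> by (intro \<Theta>_eq) (auto simp: \<Theta>_mult reduce_id)
    moreover have "z \<in> span Y \<union> span Z"
      using yz \<open>e \<in> X\<close> assms by (auto simp: span_def)
    ultimately show ?case
      using Cons.IH[OF yz(1,2)] by (auto intro: generate.intros)
  qed
  then show "carrier G \<subseteq> generate G (span Y \<union> span Z)" by auto
qed

text \<open>
  A product of nontrivial elements taken alternately from the two subgroups is spelled by the
  concatenation of their words, in which nothing cancels.
\<close>

lemma \<Theta>_alternating_product:
  assumes disj: "Y \<inter> Z = {}" and Y: "\<And>x. x \<in> Y \<Longrightarrow> iv x \<in> Y" and Z: "\<And>x. x \<in> Z \<Longrightarrow> iv x \<in> Z"
    and "\<forall>(i, h)\<in>set w. h \<in> span (if i then Y else Z) \<and> h \<noteq> \<one>"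
    and "successively (\<lambda>x y. fst x \<noteq> fst y) w"
  shows "foldr (\<otimes>) (map snd w) \<one> \<in> carrier G \<and>
    \<Theta> (foldr (\<otimes>) (map snd w) \<one>) = concat (map (\<lambda>a. \<Theta> (snd a)) w)"
  using assms(4,5)
proof (induction w)
  case Nil
  then show ?case by (simp add: \<Theta>_one)
next
  case (Cons ih w)
  obtain i h where ih: "ih = (i, h)" by fastforce
  let ?p = "foldr (\<otimes>) (map snd w) \<one>"
  have IH: "?p \<in> carrier G" "\<Theta> ?p = concat (map (\<lambda>a. \<Theta> (snd a)) w)"
    using Cons by (auto simp: successively_Cons)
  have h: "h \<in> carrier G" "set (\<Theta> h) \<subseteq> (if i then Y else Z)" "h \<noteq> \<one>"
    using Cons.prems ih by (auto simp: span_def)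
  have "reduced iv (\<Theta> h @ \<Theta> ?p)"
  proof (cases w)
    case Nil
    then show ?thesis using h reduced_\<Theta> by (simp add: \<Theta>_one)
  next
    case (Cons jk w')
    obtain j k where jk: "jk = (j, k)" by fastforce
    have k: "k \<in> carrier G" "set (\<Theta> k) \<subseteq> (if i then Z else Y)" "k \<noteq> \<one>"
      using Cons.prems ih jk Cons by (auto simp: span_def split: if_splits)
    have ne: "\<Theta> k \<noteq> []" "\<Theta> h \<noteq> []"
      using h k \<Theta>_inj by auto
    have "hd (\<Theta> k) \<noteq> iv (last (\<Theta> h))"
      using k(2) h(2) disj Y[of "last (\<Theta> h)"] Z[of "last (\<Theta> h)"]
        last_in_set[OF ne(2)] hd_in_set[OF ne(1)]
      by (cases i) (auto, blast+)
    moreover have "hd (\<Theta> ?p) = hd (\<Theta> k)"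
      using IH(2) ne Cons jk by simp
    ultimately show ?thesis
      using reduced_\<Theta>[OF h(1)] reduced_\<Theta>[OF IH(1)] by (auto simp: reduced_def successively_append_iff)
  qed
  then show ?case
    using IH h ih by (simp add: \<Theta>_mult reduce_id)
qed

lemma free_factor_span:
  assumes "Y \<union> Z = X" "Y \<inter> Z = {}"
    and Y: "\<And>x. x \<in> Y \<Longrightarrow> iv x \<in> Y" and Z: "\<And>x. x \<in> Z \<Longrightarrow> iv x \<in> Z"
  shows "free_factor G (span Y)"
  unfolding free_factor_def is_free_product_def
proof (intro exI[of _ "span Z"] conjI allI impI ballI)
  show "subgroup (if b then span Y else span Z) G" for b
    using span_subgroup[of Y] span_subgroup[of Z] Y Z by auto
  show "generate G (\<Union>b\<in>UNIV. if b then span Y else span Z) = carrier G"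
    using span_generate[OF assms(1)] by (auto simp: UNIV_bool Un_commute)
  fix w :: "(bool \<times> 'a) list"
  assume w: "w \<noteq> []" "\<forall>(i, h)\<in>set w. i \<in> UNIV \<and> h \<in> (if i then span Y else span Z) \<and> h \<noteq> \<one>"
    "successively (\<lambda>x y. fst x \<noteq> fst y) w"
  have "\<forall>(i, h)\<in>set w. h \<in> span (if i then Y else Z) \<and> h \<noteq> \<one>"
    using w(2) by (auto split: if_splits)
  from \<Theta>_alternating_product[OF assms(2) Y Z this w(3)]
  have *: "\<Theta> (foldr (\<otimes>) (map snd w) \<one>) = concat (map (\<lambda>a. \<Theta> (snd a)) w)" by simp
  obtain i h w' where "w = (i, h) # w'" using w(1) by (metis list.exhaust surj_pair)
  moreover then have "\<Theta> h \<noteq> []" using w(2) \<Theta>_inj by (auto simp: span_def split: if_splits)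
  ultimately show "foldr (\<otimes>) (map snd w) \<one> \<noteq> \<one>" using * \<Theta>_one by auto
qed

end

lemma free_basis_free_group: "free_basis (free_group r) letter_inv (letters r) (\<lambda>w. w)"
proof -
  interpret group "free_group r" by (rule group_free_group)
  show ?thesis
    by unfold_locales (auto simp: free_group_def reduced_def)
qed

section \<open>Residual finiteness and the Hopf property\<close>

lemma injection_extends_to_permutation:
  assumes "finite S" "E \<subseteq> S" "inj_on f E" "f ` E \<subseteq> S"
  shows "\<exists>p. p permutes S \<and> (\<forall>x\<in>E. p x = f x)"
proof -
  have "card (S - E) = card (S - f ` E)"
    using assms by (simp add: card_Diff_subset finite_subset card_image)
  then obtain h where h: "bij_betw h (S - E) (S - f ` E)"
    using assms by (metis finite_Diff finite_same_card_bij)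
  let ?p = "\<lambda>x. if x \<in> E then f x else if x \<in> S then h x else x"
  have 1: "bij_betw ?p E (f ` E)"
    using assms(3) by (simp add: bij_betw_def inj_on_def)
  have 2: "bij_betw ?p (S - E) (S - f ` E)"
    using h by (rule bij_betw_cong[THEN iffD1, rotated]) auto
  have "bij_betw ?p (E \<union> (S - E)) (f ` E \<union> (S - f ` E))"
    by (rule bij_betw_combine[OF 1 2]) auto
  moreover have "E \<union> (S - E) = S" "f ` E \<union> (S - f ` E) = S" using assms by auto
  ultimately have "?p permutes S"
    using assms(2) by (intro bij_imp_permutes) auto
  then show ?thesis by (intro exI[of _ ?p]) auto
qed

lemma free_group_mult: "u \<otimes>\<^bsub>free_group r\<^esub> v = reduce letter_inv (u @ v)"
  and free_group_one: "\<one>\<^bsub>free_group r\<^esub> = []"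
  and free_group_carrier: "w \<in> carrier (free_group r) \<longleftrightarrow> set w \<subseteq> letters r \<and> reduced letter_inv w"
  by (simp_all add: free_group_def)

text \<open>
  The generators act on \<open>{1..n+1}\<close>, where \<open>n\<close> is the length of \<open>w = w\<^sub>1\<dots>w\<^sub>n\<close>, in such a way that \<open>w\<^sub>j\<close> moves
  \<open>j + 1\<close> to \<open>j\<close>. Each generator is thereby prescribed on part of the points; this is consistent and injective
  because \<open>w\<close> is reduced, so it extends to a permutation. The word \<open>w\<close> then moves \<open>n + 1\<close> to \<open>1\<close>.
\<close>

lemma free_group_residually_finite:
  assumes w: "w \<in> carrier (free_group r)" "w \<noteq> []"
  shows "\<exists>n. \<exists>q\<in>hom (free_group r) (sym_group n). q w \<noteq> id"
proof -
  define n where "n = length w"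
  have red: "w ! Suc j \<noteq> letter_inv (w ! j)" if "Suc j < n" for j
    using w that by (simp add: free_group_carrier reduced_def successively_conv_nth n_def)
  (* List positions start at 0, so the letter at position j moves the point j + 2 to j + 1. *)
  define A where "A i = {j + 2 | j. j < n \<and> w ! j = (i, True)}" for i
  define B where "B i = {j + 1 | j. j < n \<and> w ! j = (i, False)}" for i
  have "\<exists>p. p permutes {1..Suc n} \<and> (\<forall>x\<in>A i \<union> B i. p x = (if x \<in> A i then x - 1 else x + 1))" for i
  proof (rule injection_extends_to_permutation)
    have sep: "x - 1 \<noteq> y + 1" if "x \<in> A i" "y \<in> B i" for x y
      using that red[of "y - 1"] by (auto simp: A_def B_def letter_inv_def)
    have pos: "x \<ge> 1" if "x \<in> A i" for x using that by (auto simp: A_def)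
    show "inj_on (\<lambda>x. if x \<in> A i then x - 1 else x + 1) (A i \<union> B i)"
    proof (rule inj_onI)
      fix x y
      assume "x \<in> A i \<union> B i" "y \<in> A i \<union> B i"
        "(if x \<in> A i then x - 1 else x + 1) = (if y \<in> A i then y - 1 else y + 1)"
      then show "x = y"
        using sep[of x y] sep[of y x] pos[of x] pos[of y] by (simp split: if_splits)
    qed
  qed (auto simp: A_def B_def)
  then obtain p where p: "p i permutes {1..Suc n}"
      "x \<in> A i \<union> B i \<Longrightarrow> p i x = (if x \<in> A i then x - 1 else x + 1)" for i x
    by metis
  have disj: "A i \<inter> B i = {}" for i
    using red by (force simp: A_def B_def letter_inv_def)
  define \<pi> where "\<pi> l = (if snd l then p (fst l) else inv' (p (fst l)))" for l :: letter
  have perm: "\<pi> l permutes {1..Suc n}" for l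
    using p(1) by (simp add: \<pi>_def permutes_inv)
  have cancel: "\<pi> l \<circ> \<pi> (letter_inv l) = id" for l
    using permutes_inv_o[OF p(1)] by (simp add: \<pi>_def letter_inv_def)
  have step: "\<pi> (w ! j) (j + 2) = j + 1" if "j < n" for j
  proof (cases "snd (w ! j)")
    case True
    then have "j + 2 \<in> A (fst (w ! j))"
      unfolding A_def using that by (auto intro!: exI[of _ j] prod_eqI)
    then show ?thesis using True p(2) by (simp add: \<pi>_def)
  next
    case False
    then have "j + 1 \<in> B (fst (w ! j))"
      unfolding B_def using that by (auto intro!: exI[of _ j] prod_eqI)
    then have "p (fst (w ! j)) (j + 1) = j + 2" using p(2) disj by fastforce
    then show ?thesis using False permutes_inverses(2)[OF p(1)] by (metis \<pi>_def)
  qed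
  define q where "q v = foldr (\<lambda>l f. \<pi> l \<circ> f) v id" for v
  have q_Cons: "q (l # v) = \<pi> l \<circ> q v" for l v by (simp add: q_def)
  have q_append: "q (u @ v) = q u \<circ> q v" for u v
    by (induction u) (simp_all add: q_def comp_assoc)
  have "q (cancel_cons letter_inv l v) = \<pi> l \<circ> q v" for l v
    using cancel[of l] by (auto simp: cancel_cons_def q_Cons simp flip: comp_assoc split: list.splits)
  then have q_reduce: "q (reduce letter_inv v) = q v" for v
    by (induction v) (auto simp: reduce_def q_Cons)
  have q_perm: "q v permutes {1..Suc n}" for v
  proof (induction v)
    case Nil
    show ?case using permutes_id by (simp add: q_def id_def)
  next
    case (Cons l v)
    show ?case unfolding q_Cons by (rule permutes_compose[OF Cons perm])
  qed
  have "q \<in> hom (free_group r) (sym_group (Suc n))"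
    using q_perm by (auto simp: hom_def sym_group_def free_group_mult q_reduce q_append)
  moreover have "q (drop k w) (n + 1) = k + 1" if "k \<le> n" for k
    using that
  proof (induction "n - k" arbitrary: k)
    case 0
    then show ?case by (simp add: n_def q_def)
  next
    case (Suc d)
    then have "drop k w = w ! k # drop (Suc k) w" by (simp add: n_def Cons_nth_drop_Suc)
    then show ?case using Suc.hyps(1)[of "Suc k"] Suc.hyps(2) Suc.prems step[of k] by (simp add: q_Cons)
  qed
  from this[of 0] have "q w (n + 1) \<noteq> n + 1" using w(2) by (simp add: n_def)
  ultimately show ?thesis by (metis id_apply)
qed

lemma finite_homs_free_group:
  assumes "group Q" "finite (carrier Q)"
  shows "finite (hom (free_group r) Q \<inter> extensional (carrier (free_group r)))" (is "finite ?H")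
proof (rule finite_imageD)
  let ?ev = "\<lambda>f. \<lambda>l\<in>letters r. f [l]"
  have letter: "[l] \<in> carrier (free_group r)" if "l \<in> letters r" for l
    using that by (simp add: free_group_carrier reduced_def)
  have "?ev ` ?H \<subseteq> letters r \<rightarrow>\<^sub>E carrier Q"
    using letter by (auto simp: hom_def)
  then show "finite (?ev ` ?H)"
    by (rule finite_subset) (auto intro!: finite_PiE assms simp: letters_def)
  have "f w = h w"
    if fh: "f \<in> ?H" "h \<in> ?H" "?ev f = ?ev h" and w: "w \<in> carrier (free_group r)" for f h w
    using w
  proof (induction w)
    case Nil
    have "f \<one>\<^bsub>free_group r\<^esub> = \<one>\<^bsub>Q\<^esub>" "h \<one>\<^bsub>free_group r\<^esub> = \<one>\<^bsub>Q\<^esub>"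
      using fh assms(1) group_free_group by (auto intro: hom_one)
    then show ?case by (simp add: free_group_one)
  next
    case (Cons l w)
    then have lw: "l \<in> letters r" "[l] \<in> carrier (free_group r)" "w \<in> carrier (free_group r)"
      by (auto simp: free_group_carrier reduced_def successively_Cons)
    have "[l] \<otimes>\<^bsub>free_group r\<^esub> w = l # w"
      using Cons.prems by (simp add: free_group_mult free_group_carrier reduce_id)
    moreover have "f [l] = h [l]" using fun_cong[OF fh(3), of l] lw by simp
    ultimately show ?case
      using Cons.IH lw fh(1,2) by (metis IntE hom_mult)
  qed
  then show "inj_on ?ev ?H"
    by (intro inj_onI) (auto intro!: extensionalityI)
qed

text \<open>
  A Hopf property of retracts \<open>A\<close> of a free group of finite rank: an automorphism \<open>\<Psi>\<close> of the
  whole group that maps \<open>A\<close> into itself maps it onto itself. Let \<open>\<rho>\<close> be the retraction. Precomposition with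
  \<open>\<rho> \<circ> \<Psi>\<inverse>\<close> is a selfmap of the finite set of homomorphisms from \<open>A\<close> to a finite group. It is
  injective, as \<open>\<rho> (\<Psi>\<inverse> (\<Psi> a)) = a\<close>, hence surjective; so no such homomorphism separates \<open>y \<in> A\<close>
  from \<open>\<Psi> (\<rho> (\<Psi>\<inverse> y))\<close>, and by residual finiteness the two are equal.
\<close>

lemma retract_invariant_imp_fixed:
  fixes G (structure)
  assumes G_def: "G = free_group r" and \<Psi>: "\<Psi> \<in> auto G" and \<rho>: "\<rho> \<in> hom G G" "\<rho> ` carrier G \<subseteq> A" "\<And>a. a \<in> A \<Longrightarrow> \<rho> a = a"
    and A: "A \<subseteq> carrier G" "\<Psi> ` A \<subseteq> A"
  shows "\<Psi> ` A = A"
proof (rule ccontr)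
  interpret group G unfolding G_def by (rule group_free_group)
  assume "\<Psi> ` A \<noteq> A"
  then obtain y where y: "y \<in> A" "y \<notin> \<Psi> ` A" using A by auto
  define \<sigma> where "\<sigma> = (\<lambda>x\<in>carrier G. inv_into (carrier G) \<Psi> x)"
  have \<Psi>': "\<Psi> \<in> hom G G" "\<Psi> \<in> Bij (carrier G)" using \<Psi> by (auto simp: auto_def)
  have \<sigma>: "\<sigma> \<in> hom G G" unfolding \<sigma>_def by (rule restrict_inv_into_hom[OF \<Psi>'])
  have bij: "bij_betw \<Psi> (carrier G) (carrier G)" using \<Psi>' by (simp add: Bij_def)
  have \<sigma>\<Psi>: "\<sigma> (\<Psi> x) = x" "\<Psi> x \<in> carrier G" if "x \<in> carrier G" for x
    using that bij by (auto simp: \<sigma>_def bij_betw_def inv_into_f_f)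
  have closed: "\<rho> x \<in> carrier G" "\<sigma> x \<in> carrier G" if "x \<in> carrier G" for x
    using hom_in_carrier[OF \<rho>(1) that] hom_in_carrier[OF \<sigma> that] by auto
  define z where "z = \<Psi> (\<rho> (\<sigma> y))"
  have y': "y \<in> carrier G" using y A by auto
  have \<rho>\<sigma>y: "\<rho> (\<sigma> y) \<in> A" "\<rho> (\<sigma> y) \<in> carrier G"
    using \<rho>(2) closed(2)[OF y'] A(1) by blast+
  have "\<sigma> z = \<rho> (\<sigma> y)"
    unfolding z_def by (rule \<sigma>\<Psi>(1)[OF \<rho>\<sigma>y(2)])
  moreover have "z \<in> \<Psi> ` A"
    unfolding z_def using \<rho>\<sigma>y(1) by (rule imageI)
  ultimately have z: "z \<in> A" "z \<in> carrier G" "\<sigma> z = \<rho> (\<sigma> y)" "z \<noteq> y"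
    using y A by auto
  have ne: "z \<otimes> inv y \<noteq> \<one>"
    using z(2,4) y' by (metis inv_closed inv_equality inv_inv)
  obtain n q where q: "q \<in> hom G (sym_group n)" "q (z \<otimes> inv y) \<noteq> id"
    using free_group_residually_finite[of "z \<otimes> inv y" r] ne m_closed[OF z(2) inv_closed[OF y']]
    unfolding G_def free_group_one by blast
  let ?Q = "sym_group n"
  interpret Q: group ?Q by (rule sym_group_is_group)
  interpret q: group_hom G ?Q q by unfold_locales (rule q(1))
  have "q z \<noteq> q y"
  proof
    assume "q z = q y"
    then have "q (z \<otimes> inv y) = q y \<otimes>\<^bsub>?Q\<^esub> inv\<^bsub>?Q\<^esub> q y" using z(2) y' by simp
    then show False
      using Q.r_inv[OF q.hom_closed[OF y']] q(2) unfolding sym_group_one by simp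
  qed
  (* The homomorphisms on A, represented by their compositions with the retraction. *)
  define P where "P = {f \<in> hom G ?Q \<inter> extensional (carrier G). \<forall>x\<in>carrier G. f (\<rho> x) = f x}"
  have "finite P"
    unfolding P_def G_def
    by (rule finite_subset[OF _ finite_homs_free_group[OF sym_group_is_group[of n], of r]])
      (auto simp: sym_group_def finite_permutations)
  let ?T = "\<lambda>f. \<lambda>x\<in>carrier G. f (\<sigma> (\<rho> x))"
  have "?T ` P \<subseteq> P"
  proof safe
    fix f assume f: "f \<in> P"
    have "(\<lambda>x. f (\<sigma> (\<rho> x))) \<in> hom G ?Q"
      using Group.hom_compose[OF \<rho>(1) Group.hom_compose[OF \<sigma>, of f ?Q]] f unfolding P_def comp_def by simp
    then have "?T f \<in> hom G ?Q" by (auto simp: hom_def)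
    then show "?T f \<in> P"
      using closed \<rho> f unfolding P_def by (auto simp: image_subset_iff)
  qed
  moreover have "inj_on ?T P"
  proof (rule inj_onI)
    fix f h assume fh: "f \<in> P" "h \<in> P" "?T f = ?T h"
    have eq: "f a = h a" if "a \<in> A" for a
    proof -
      have "\<Psi> a \<in> A" "a \<in> carrier G" using that A by auto
      then show ?thesis
        using fun_cong[OF fh(3), of "\<Psi> a"] \<sigma>\<Psi>[of a] \<rho>(3)[of "\<Psi> a"] by simp
    qed
    have "f x = h x" if "x \<in> carrier G" for x
    proof -
      have "f (\<rho> x) = f x" "h (\<rho> x) = h x" using fh(1,2) that unfolding P_def by blast+
      moreover have "\<rho> x \<in> A" using \<rho>(2) that by blast
      ultimately show ?thesis using eq by metis
    qed
    then show "f = h" using fh by (intro extensionalityI[of _ "carrier G"]) (auto simp: P_def)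
  qed
  ultimately have T: "?T ` P = P" using \<open>finite P\<close> by (simp add: endo_inj_surj)
  have "(\<lambda>x. q (\<rho> x)) \<in> hom G ?Q" using Group.hom_compose[OF \<rho>(1) q(1)] by (simp add: comp_def)
  then have "(\<lambda>x\<in>carrier G. q (\<rho> x)) \<in> hom G ?Q" by (auto simp: hom_def)
  then have "(\<lambda>x\<in>carrier G. q (\<rho> x)) \<in> P"
    using closed \<rho> unfolding P_def by (auto simp: image_subset_iff)
  then obtain f where f: "f \<in> P" "(\<lambda>x\<in>carrier G. q (\<rho> x)) = ?T f" using T by blast
  have "q x = f (\<sigma> x)" if "x \<in> A" for x
    using fun_cong[OF f(2), of x] that A \<rho>(3)[OF that] by (auto split: if_splits)
  from this[OF z(1)] this[OF y(1)] have "q z = f (\<rho> (\<sigma> y))" "q y = f (\<sigma> y)"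
    unfolding z(3) .
  moreover have "f (\<rho> (\<sigma> y)) = f (\<sigma> y)" using f(1) closed(2)[OF y'] unfolding P_def by blast
  ultimately show False using \<open>q z \<noteq> q y\<close> by simp
qed

text \<open>Deleting the letters outside \<open>Y\<close> retracts the group onto \<open>span Y\<close>.\<close>

lemma (in free_basis) retraction_span:
  assumes "Y \<subseteq> X" and Y: "\<And>x. iv x \<in> Y \<longleftrightarrow> x \<in> Y"
  shows "\<exists>\<rho>\<in>hom G G. \<rho> ` carrier G \<subseteq> span Y \<and> (\<forall>a\<in>span Y. \<rho> a = a)"
proof -
  let ?f = "\<lambda>w. reduce iv (filter (\<lambda>e. e \<in> Y) w)"
  have filter_concat: "filter (\<lambda>e. e \<in> Y) w = concat (map (\<lambda>e. if e \<in> Y then [e] else []) w)" for w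
    by (induction w) auto
  have f_cong: "?f v = ?f w" if "homotopic iv v w" for v w
    unfolding filter_concat
    by (rule homotopic_concat_map) (use that Y in \<open>auto simp: path_inv_def involution_axioms\<close>)
  have "\<exists>y\<in>carrier G. \<Theta> y = ?f (\<Theta> x)" for x
    using assms(1) set_reduce_subset[of "filter (\<lambda>e. e \<in> Y) (\<Theta> x)"]
    by (intro \<Theta>_surj reduced_reduce) auto
  then obtain \<rho> where \<rho>: "\<rho> x \<in> carrier G" "\<Theta> (\<rho> x) = ?f (\<Theta> x)" for x by metis
  show ?thesis
  proof (intro bexI[of _ \<rho>] conjI ballI)
    show "\<rho> \<in> hom G G"
    proof (rule homI)
      fix x y assume xy: "x \<in> carrier G" "y \<in> carrier G"
      have "\<Theta> (\<rho> (x \<otimes> y)) = ?f (\<Theta> x @ \<Theta> y)"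
        using xy f_cong[of "reduce iv (\<Theta> x @ \<Theta> y)" "\<Theta> x @ \<Theta> y"] by (simp add: \<rho> \<Theta>_mult)
      also have "\<dots> = \<Theta> (\<rho> x \<otimes> \<rho> y)"
        by (simp add: \<rho> \<Theta>_mult reduce_append_reduce)
      finally show "\<rho> (x \<otimes> y) = \<rho> x \<otimes> \<rho> y"
        using \<rho> by (intro \<Theta>_eq) auto
    qed (simp add: \<rho>)
    show "\<rho> ` carrier G \<subseteq> span Y"
      using set_reduce_subset by (fastforce simp: span_def \<rho>)
    show "\<rho> a = a" if a: "a \<in> span Y" for a
    proof (rule \<Theta>_eq)
      have "filter (\<lambda>e. e \<in> Y) (\<Theta> a) = \<Theta> a"
        using a by (auto simp: span_def filter_id_conv)
      then show "\<Theta> (\<rho> a) = \<Theta> a"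
        using a reduced_\<Theta>[of a] by (simp add: \<rho> span_def reduce_id)
    qed (use a \<rho> in \<open>auto simp: span_def\<close>)
  qed
qed

section \<open>Outer automorphisms\<close>

text \<open>The members of an outer automorphism differ by inner automorphisms.\<close>

lemma (in group) mem_Out:
  assumes "\<phi> \<in> carrier (Out G)" "\<Psi> \<in> \<phi>"
  shows "\<Psi> \<in> auto G"
    and "\<phi> = {compose (carrier G) (\<lambda>x\<in>carrier G. a \<otimes> x \<otimes> inv a) \<Psi> | a. a \<in> carrier G}"
proof -
  interpret A: normal "Inn G" "AutoGroup G" by (rule normal_Inn)
  have A: "carrier (AutoGroup G) = auto G" by (simp add: AutoGroup_def)
  have Inn: "Inn G \<subseteq> auto G" using A.subset A by simp
  from assms(1) obtain \<Phi> where \<Phi>: "\<Phi> \<in> auto G" "\<phi> = Inn G #>\<^bsub>AutoGroup G\<^esub> \<Phi>"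
    by (auto simp: Out_def FactGroup_def RCOSETS_def A)
  then show \<Psi>: "\<Psi> \<in> auto G"
    using assms(2) A.r_coset_subset_G[OF A.subset, of \<Phi>] A by auto
  have "\<phi> = Inn G #>\<^bsub>AutoGroup G\<^esub> \<Psi>"
    using A.repr_independence[of \<Psi> "Inn G" \<Phi>] assms(2) \<Phi> A A.is_subgroup by simp
  moreover have "h \<otimes>\<^bsub>AutoGroup G\<^esub> \<Psi> = compose (carrier G) h \<Psi>" if "h \<in> Inn G" for h
    using that Inn \<Psi> by (auto simp: AutoGroup_def BijGroup_def auto_def)
  ultimately show "\<phi> = {compose (carrier G) (\<lambda>x\<in>carrier G. a \<otimes> x \<otimes> inv a) \<Psi> | a. a \<in> carrier G}"
    unfolding r_coset_def by (force simp: Inn_def)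
qed

lemma (in group) group_Out: "group (Out G)"
  unfolding Out_def by (rule normal.factorgroup_is_group[OF normal_Inn])

lemma (in group) compose_mem_Out_pow:
  assumes "\<phi> \<in> carrier (Out G)" "\<Psi> \<in> \<phi> [^]\<^bsub>Out G\<^esub> (n::nat)" "\<Phi> \<in> \<phi>"
  shows "compose (carrier G) \<Psi> \<Phi> \<in> \<phi> [^]\<^bsub>Out G\<^esub> Suc n"
proof -
  interpret O: group "Out G" by (rule group_Out)
  have "\<Psi> \<in> auto G" "\<Phi> \<in> auto G"
    using mem_Out(1)[of "\<phi> [^]\<^bsub>Out G\<^esub> n" \<Psi>] mem_Out(1)[of \<phi> \<Phi>] assms by auto
  then have "compose (carrier G) \<Psi> \<Phi> = \<Psi> \<otimes>\<^bsub>AutoGroup G\<^esub> \<Phi>"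
    by (auto simp: AutoGroup_def BijGroup_def auto_def)
  then show ?thesis
    using assms by (auto simp: Out_def set_mult_def)
qed

lemma (in group) id_mem_Out_pow: "(\<lambda>x\<in>carrier G. x) \<in> \<phi> [^]\<^bsub>Out G\<^esub> (0::nat)"
proof -
  have "(\<lambda>x\<in>carrier G. x) = (\<lambda>x\<in>carrier G. \<one> \<otimes> x \<otimes> inv \<one>)" by (auto simp: fun_eq_iff)
  then have "(\<lambda>x\<in>carrier G. x) \<in> Inn G" unfolding Inn_def using one_closed by blast
  then show ?thesis unfolding Out_def by simp
qed

lemma (in group) is_free_product_single:
  assumes "subgroup A G"
  shows "is_free_product G {..<1::nat} (\<lambda>i. A) A"
  unfolding is_free_product_def
proof (intro conjI allI impI ballI)
  show "generate G (\<Union>i\<in>{..<1::nat}. A) = A"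
    using generateI[OF assms, of A] by (simp add: lessThan_Suc)
  fix w :: "(nat \<times> 'a) list"
  assume w: "w \<noteq> []" "\<forall>(i, h)\<in>set w. i \<in> {..<1} \<and> h \<in> A \<and> h \<noteq> \<one>" "successively (\<lambda>x y. fst x \<noteq> fst y) w"
  obtain x v where xv: "w = x # v" using w(1) by (cases w) auto
  have "v = []"
  proof (cases v)
    case (Cons y v')
    then show ?thesis using w(2,3) xv by auto
  qed
  then show "foldr (\<otimes>) (map snd w) \<one> \<noteq> \<one>"
    using w(2) xv subgroup.mem_carrier[OF assms] by auto
qed (use assms in auto)

text \<open>A single invariant conjugacy class of free factors already witnesses reducibility.\<close>

lemma (in group) reducible_of_invariant_free_factor:
  assumes \<phi>: "\<phi> \<in> carrier (Out G)" and \<Psi>: "\<Psi> \<in> \<phi>"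
    and A: "free_factor G A" "A \<noteq> {\<one>}" "A \<noteq> carrier G" and inv: "\<Psi> ` A = A"
  shows "reducible G \<phi>"
proof -
  from A(1) obtain B where "is_free_product G (UNIV :: bool set) (\<lambda>b. if b then A else B) (carrier G)"
    by (auto simp: free_factor_def)
  then have "\<forall>b\<in>UNIV. subgroup (if b then A else B) G" unfolding is_free_product_def by blast
  then have "subgroup A G" by (simp add: all_bool_eq)
  then have sub: "A \<subseteq> carrier G" by (rule subgroup.subset)
  let ?c = "\<lambda>a x. a \<otimes> x \<otimes> inv a"
  have \<Psi>': "\<Psi> \<in> hom G G" "bij_betw \<Psi> (carrier G) (carrier G)"
    using mem_Out(1)[OF \<phi> \<Psi>] by (auto simp: auto_def Bij_def)
  interpret \<Psi>: group_hom G G \<Psi> by unfold_locales (rule \<Psi>'(1))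
  have image: "compose (carrier G) (\<lambda>x\<in>carrier G. ?c a x) \<Psi> ` (?c b ` A) = ?c (a \<otimes> \<Psi> b) ` A"
    if "a \<in> carrier G" "b \<in> carrier G" for a b
  proof -
    have "compose (carrier G) (\<lambda>x\<in>carrier G. ?c a x) \<Psi> (?c b h) = ?c (a \<otimes> \<Psi> b) (\<Psi> h)" if "h \<in> A" for h
      using that sub \<open>a \<in> carrier G\<close> \<open>b \<in> carrier G\<close>
      by (auto simp: compose_def m_assoc inv_mult_group subset_iff)
    then have "compose (carrier G) (\<lambda>x\<in>carrier G. ?c a x) \<Psi> ` (?c b ` A) = ?c (a \<otimes> \<Psi> b) ` (\<Psi> ` A)"
      unfolding image_image by (intro image_cong) auto
    then show ?thesis unfolding inv .
  qed
  have out: "out_image \<phi> (conj_class G A) = conj_class G A"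
  proof
    show "out_image \<phi> (conj_class G A) \<subseteq> conj_class G A"
      unfolding out_image_def conj_class_def mem_Out(2)[OF \<phi> \<Psi>] using image by auto (metis \<Psi>.hom_closed m_closed)
    show "conj_class G A \<subseteq> out_image \<phi> (conj_class G A)"
    proof
      fix K assume "K \<in> conj_class G A"
      then obtain a where a: "a \<in> carrier G" "K = ?c a ` A" by (auto simp: conj_class_def)
      have "compose (carrier G) (\<lambda>x\<in>carrier G. ?c a x) \<Psi> ` (?c \<one> ` A) = ?c a ` A"
        using image[OF a(1) one_closed] a(1) by simp
      moreover have "compose (carrier G) (\<lambda>x\<in>carrier G. ?c a x) \<Psi> \<in> \<phi>"
        by (subst mem_Out(2)[OF \<phi> \<Psi>]) (use a in auto)
      ultimately show "K \<in> out_image \<phi> (conj_class G A)"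
        unfolding out_image_def conj_class_def using a(2) one_closed by blast
    qed
  qed
  show ?thesis
    unfolding reducible_def
  proof (intro exI[of _ "1::nat"] exI[of _ "\<lambda>i. A"] conjI)
    show "\<exists>K. is_free_product G {..<1::nat} (\<lambda>i. A) K \<and> free_factor G K"
      using is_free_product_single[OF \<open>subgroup A G\<close>] A(1) by blast
    show "bij_betw (out_image \<phi>) ((\<lambda>i. conj_class G A) ` {..<1::nat}) ((\<lambda>i. conj_class G A) ` {..<1::nat})"
      using out by (simp add: lessThan_Suc bij_betw_def)
  qed (use A in auto)
qed

text \<open>
  It suffices that the free factor is mapped into itself, by the Hopf property.
\<close>

lemma reducible_of_invariant_span:
  assumes basis: "free_basis (free_group r) iv X \<Theta>"
    and \<phi>: "\<phi> \<in> carrier (Out (free_group r))" "\<Psi> \<in> \<phi>"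
    and YX: "Y \<subset> X" "Y \<noteq> {}" and Y: "\<And>x. iv x \<in> Y \<longleftrightarrow> x \<in> Y"
    and inv: "\<Psi> ` free_basis.span (free_group r) \<Theta> Y \<subseteq> free_basis.span (free_group r) \<Theta> Y"
  shows "reducible (free_group r) \<phi>"
proof -
  interpret free_basis "free_group r" iv X \<Theta> by (rule basis)
  have \<Psi>: "\<Psi> \<in> auto (free_group r)" using \<phi> by (rule mem_Out)
  have "free_factor (free_group r) (span Y)"
    by (rule free_factor_span[where Z = "X - Y"]) (use YX Y iv_X in auto)
  moreover obtain e f where ef: "e \<in> Y" "f \<in> X - Y" using YX by auto
  then obtain x y where "x \<in> carrier (free_group r)" "\<Theta> x = [e]" "y \<in> carrier (free_group r)" "\<Theta> y = [f]"
    using \<Theta>_letter[of e] \<Theta>_letter[of f] YX by blast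
  then have "x \<in> span Y" "x \<noteq> \<one>\<^bsub>free_group r\<^esub>" "y \<in> carrier (free_group r) - span Y"
    using ef \<Theta>_one by (auto simp: span_def)
  moreover obtain \<rho> where "\<rho> \<in> hom (free_group r) (free_group r)"
    "\<rho> ` carrier (free_group r) \<subseteq> span Y" "\<forall>a\<in>span Y. \<rho> a = a"
    using retraction_span[of Y] YX Y by auto
  then have "\<Psi> ` span Y = span Y"
    using inv by (intro retract_invariant_imp_fixed[OF HOL.refl \<Psi>, of \<rho>]) (auto simp: span_def)
  ultimately show ?thesis
    using reducible_of_invariant_free_factor[OF \<phi>] by blast
qed

section \<open>Edge paths, graph maps and spanning trees\<close>

text \<open>
  Reduction only inverts letters of the word; so \<open>letter_inv\<close> and \<open>rose_rev\<close>, which differ outside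
  the petals, reduce words of petals alike.
\<close>

lemma reduce_cong:
  assumes "\<And>x. x \<in> set w \<Longrightarrow> iv x = iv' x" shows "reduce iv w = reduce iv' w"
  using assms by (induction w) (auto simp: reduce_def cancel_cons_def split: list.splits)

sublocale bidirected_digraph \<subseteq> involution arev
  by unfold_locales simp

lemma path_map_Nil [simp]: "path_map f [] = []"
  and path_map_Cons [simp]: "path_map f (e # p) = emap f e @ path_map f p"
  and path_map_append [simp]: "path_map f (p @ q) = path_map f p @ path_map f q"
  by (simp_all add: path_map_def)

context bidirected_digraph
begin

lemma awalk_path_inv: "awalk u p v \<Longrightarrow> awalk v (path_inv arev p) u"
proof (induction p arbitrary: u)
  case Nil
  then show ?case by (auto simp: awalk_Nil_iff)
next
  case (Cons e p)
  then have e: "e \<in> arcs G" "u = tail G e" "awalk (head G e) p v"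
    by (simp_all add: awalk_Cons_iff)
  then have "awalk (head G e) [arev e] u"
    using arc_implies_awalk[of "arev e"] by simp
  then show ?case
    using awalk_appendI[OF Cons.IH[OF e(3)]] by (simp add: path_inv_def)
qed

context
  fixes \<Delta> :: "('w, 'f) pre_digraph" and rv' :: "'f \<Rightarrow> 'f" and f :: "('a, 'b, 'w, 'f) graph_map"
  assumes f: "is_graph_map G arev \<Delta> rv' f" and \<Delta>: "bidirected_digraph \<Delta> rv'"
begin

interpretation \<Delta>: bidirected_digraph \<Delta> rv' by (rule \<Delta>)

lemma awalk_path_map: "awalk u p v \<Longrightarrow> \<Delta>.awalk (vmap f u) (path_map f p) (vmap f v)"
proof (induction p arbitrary: u)
  case Nil
  then show ?case
    using f by (auto simp: awalk_Nil_iff \<Delta>.awalk_Nil_iff is_graph_map_def)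
next
  case (Cons e p)
  then have e: "e \<in> arcs G" "u = tail G e" "awalk (head G e) p v"
    by (simp_all add: awalk_Cons_iff)
  then have "\<Delta>.awalk (vmap f u) (emap f e) (vmap f (head G e))"
    using f by (auto simp: is_graph_map_def)
  from \<Delta>.awalk_appendI[OF this Cons.IH[OF e(3)]] show ?case by simp
qed

lemma path_map_path_inv:
  "set p \<subseteq> arcs G \<Longrightarrow> path_map f (path_inv arev p) = path_inv rv' (path_map f p)"
  by (induction p) (use f in \<open>auto simp: path_inv_def is_graph_map_def\<close>)

lemma homotopic_path_map:
  assumes "homotopic arev p q" "set p \<subseteq> arcs G" "set q \<subseteq> arcs G"
  shows "homotopic rv' (path_map f p) (path_map f q)"
  unfolding path_map_def
  by (rule homotopic_concat_map)
    (use assms f in \<open>auto simp: is_graph_map_def \<Delta>.involution_axioms\<close>)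

lemma set_path_map: "set p \<subseteq> arcs G \<Longrightarrow> set (path_map f p) \<subseteq> arcs \<Delta>"
  by (induction p) (use f in \<open>auto simp: is_graph_map_def \<Delta>.awalk_def\<close>)

end

text \<open>A free homotopy between graph maps conjugates the images of paths by its tracks.\<close>

lemma map_homotopicD:
  assumes "map_homotopic G \<Delta> rv' f h" "bidirected_digraph \<Delta> rv'"
  shows "\<exists>P. (\<forall>v\<in>verts G. edge_path \<Delta> (vmap f v) (P v) (vmap h v)) \<and>
    (\<forall>u p v. awalk u p v \<longrightarrow> homotopic rv' (path_map f p @ P v) (P u @ path_map h p))"
proof -
  interpret \<Delta>: bidirected_digraph \<Delta> rv' by (rule assms(2))
  from assms(1) obtain P
    where P: "\<And>v. v \<in> verts G \<Longrightarrow> edge_path \<Delta> (vmap f v) (P v) (vmap h v)"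
      and "\<And>e. e \<in> arcs G \<Longrightarrow>
        path_homotopic \<Delta> rv' (emap f e @ P (head G e)) (P (tail G e) @ emap h e)"
    unfolding map_homotopic_def by blast
  then have sq: "homotopic rv' (emap f e @ P (head G e)) (P (tail G e) @ emap h e)"
    if "e \<in> arcs G" for e
    using that by (blast intro: \<Delta>.homotopic_of_path_homotopic)
  have "homotopic rv' (path_map f p @ P v) (P u @ path_map h p)" if "awalk u p v" for u p v
    using that
  proof (induction p arbitrary: u)
    case Nil
    then show ?case by (simp add: awalk_Nil_iff)
  next
    case (Cons e p)
    then have e: "e \<in> arcs G" "u = tail G e" "awalk (head G e) p v"
      by (simp_all add: awalk_Cons_iff)
    have "homotopic rv' (emap f e @ (path_map f p @ P v)) (emap f e @ (P (head G e) @ path_map h p))"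
      by (rule \<Delta>.homotopic_append) (simp_all add: Cons.IH[OF e(3)])
    moreover have "homotopic rv' ((emap f e @ P (head G e)) @ path_map h p) ((P (tail G e) @ emap h e) @ path_map h p)"
      by (rule \<Delta>.homotopic_append) (simp_all add: sq e)
    ultimately show ?case using e by simp
  qed
  with P show ?thesis by (intro exI[of _ P]) simp
qed

text \<open>
  A tree \<open>T\<close> with root \<open>w\<close> and vertex set \<open>W\<close>, grown by adding one edge at a time; \<open>\<tau> u\<close> is
  the path in \<open>T\<close> from the root to \<open>u\<close>.
\<close>

inductive rooted_tree :: "'a \<Rightarrow> 'a set \<Rightarrow> 'b set \<Rightarrow> ('a \<Rightarrow> 'b list) \<Rightarrow> bool" for w :: 'a where
  root: "w \<in> verts G \<Longrightarrow> rooted_tree w {w} {} (\<lambda>_. [])"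
| grow: "rooted_tree w W T \<tau> \<Longrightarrow> e \<in> arcs G \<Longrightarrow> tail G e \<in> W \<Longrightarrow> head G e \<notin> W \<Longrightarrow>
    rooted_tree w (insert (head G e) W) (T \<union> {e, arev e}) (\<tau>(head G e := \<tau> (tail G e) @ [e]))"

lemma rooted_treeD:
  assumes "rooted_tree w W T \<tau>"
  shows "w \<in> W" "W \<subseteq> verts G" "T \<subseteq> arcs G" "arev ` T \<subseteq> T" "\<tau> w = []"
    "e \<in> T \<Longrightarrow> tail G e \<in> W" "e \<in> T \<Longrightarrow> head G e \<in> W"
    "u \<in> W \<Longrightarrow> awalk w (\<tau> u) u" "u \<in> W \<Longrightarrow> set (\<tau> u) \<subseteq> T"
    "e \<in> T \<Longrightarrow> homotopic arev (\<tau> (tail G e) @ [e]) (\<tau> (head G e))"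
proof -
  have *: "w \<in> W \<and> W \<subseteq> verts G \<and> T \<subseteq> arcs G \<and> arev ` T \<subseteq> T \<and> \<tau> w = [] \<and>
    (\<forall>e\<in>T. tail G e \<in> W \<and> head G e \<in> W \<and> homotopic arev (\<tau> (tail G e) @ [e]) (\<tau> (head G e))) \<and>
    (\<forall>u\<in>W. awalk w (\<tau> u) u \<and> set (\<tau> u) \<subseteq> T)"
    using assms
  proof induction
    case root
    then show ?case by (simp add: awalk_Nil_iff)
  next
    case (grow W T \<tau> e)
    let ?\<tau> = "\<tau>(head G e := \<tau> (tail G e) @ [e])"
    have old: "?\<tau> u = \<tau> u" if "u \<in> W" for u using that grow by auto
    have new: "?\<tau> (head G e) = \<tau> (tail G e) @ [e]" by simp
    have awalk: "awalk w (\<tau> (tail G e) @ [e]) (head G e)"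
      using grow arc_implies_awalk[of e] by (auto intro: awalk_appendI)
    have "homotopic arev (\<tau> (tail G e) @ [e, arev e]) (\<tau> (tail G e))"
      using homotopic_cancel_inner(2)[of "\<tau> (tail G e)" "[e]" "[]"] by (simp add: path_inv_def)
    then have "\<forall>a\<in>{e, arev e}. homotopic arev (?\<tau> (tail G a) @ [a]) (?\<tau> (head G a))"
      using grow old[of "tail G e"] by auto
    moreover have "\<forall>a\<in>T. homotopic arev (?\<tau> (tail G a) @ [a]) (?\<tau> (head G a))"
      using grow old by auto
    moreover have "\<forall>u\<in>insert (head G e) W. awalk w (?\<tau> u) u \<and> set (?\<tau> u) \<subseteq> T \<union> {e, arev e}"
      using grow old awalk by auto
    ultimately show ?case
      using grow old[of w] by auto
  qed
  show "w \<in> W" "W \<subseteq> verts G" "T \<subseteq> arcs G" "arev ` T \<subseteq> T" "\<tau> w = []"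
    using * by simp_all
  show "tail G e \<in> W" "head G e \<in> W" "homotopic arev (\<tau> (tail G e) @ [e]) (\<tau> (head G e))"
    if "e \<in> T" using * that by simp_all
  show "awalk w (\<tau> u) u" "set (\<tau> u) \<subseteq> T" if "u \<in> W" using * that by simp_all
qed

text \<open>
  A tree can be grown by edges from \<open>S\<close> until no edge of \<open>S\<close> leaves it. If it grows at all, then
  the vertex that was added last is a leaf.
\<close>

lemma rooted_tree_extend:
  assumes "finite (verts G)" "rooted_tree w W T \<tau>" "S \<subseteq> arcs G" "arev ` S \<subseteq> S"
  shows "\<exists>W' T' \<tau>'. rooted_tree w W' T' \<tau>' \<and> W \<subseteq> W' \<and> T \<subseteq> T' \<and> T' \<subseteq> T \<union> S \<and> (\<forall>u\<in>W. \<tau>' u = \<tau> u) \<and>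
    (\<forall>e\<in>S. tail G e \<in> W' \<longrightarrow> head G e \<in> W') \<and>
    (W' = W \<and> T' = T \<or> (\<exists>u\<in>W' - W. \<exists>a. {e\<in>T'. tail G e = u} = {a}))"
  using assms(2)
proof (induction "card (verts G - W)" arbitrary: W T \<tau> rule: less_induct)
  case less
  show ?case
  proof (cases "\<forall>e\<in>S. tail G e \<in> W \<longrightarrow> head G e \<in> W")
    case True
    then show ?thesis using less.prems by blast
  next
    case False
    then obtain e where e: "e \<in> S" "tail G e \<in> W" "head G e \<notin> W" by blast
    let ?W = "insert (head G e) W" and ?T = "T \<union> {e, arev e}"
    let ?\<tau> = "\<tau>(head G e := \<tau> (tail G e) @ [e])"
    have e': "e \<in> arcs G" "arev e \<in> S" using e assms(3,4) by auto
    have step: "rooted_tree w ?W ?T ?\<tau>"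
      by (rule rooted_tree.grow[OF less.prems e'(1) e(2,3)])
    have "head G e \<in> verts G - W" using e(3) e'(1) by simp
    then have "verts G - ?W \<subset> verts G - W" by blast
    then have "card (verts G - ?W) < card (verts G - W)"
      using assms(1) by (simp add: psubset_card_mono)
    from less.hyps[OF this step] obtain W' T' \<tau>' where
      IH: "rooted_tree w W' T' \<tau>'" "?W \<subseteq> W'" "?T \<subseteq> T'" "T' \<subseteq> ?T \<union> S" "\<forall>u\<in>?W. \<tau>' u = ?\<tau> u"
        "\<forall>e\<in>S. tail G e \<in> W' \<longrightarrow> head G e \<in> W'"
        "W' = ?W \<and> T' = ?T \<or> (\<exists>u\<in>W' - ?W. \<exists>a. {e\<in>T'. tail G e = u} = {a})"
      by (elim exE conjE) (rule that; assumption)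
    have "\<exists>u\<in>W' - W. \<exists>a. {e\<in>T'. tail G e = u} = {a}"
      using IH(7)
    proof (elim disjE)
      assume "W' = ?W \<and> T' = ?T"
      moreover have "{a\<in>?T. tail G a = head G e} = {arev e}"
        using rooted_treeD(6)[OF less.prems] e e' by auto metis
      ultimately show ?thesis using e by blast
    qed blast
    moreover have "\<forall>u\<in>W. \<tau>' u = \<tau> u" using IH(5) e by auto
    ultimately show ?thesis
      using IH(1-4,6) e(1) e'(2) by (intro exI[of _ W'] exI[of _ T'] exI[of _ \<tau>'] conjI) auto
  qed
qed

lemma reachable_set_eq_verts:
  assumes "connected G" "w \<in> W" "W \<subseteq> verts G" "\<And>e. e \<in> arcs G \<Longrightarrow> tail G e \<in> W \<Longrightarrow> head G e \<in> W"
  shows "W = verts G"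
proof -
  have "v \<in> W" if "v \<in> verts G" for v
  proof -
    have "w \<rightarrow>\<^sup>*\<^bsub>mk_symmetric G\<^esub> v"
      using assms(1-3) that by (auto simp: connected_def strongly_connected_def)
    then have "w \<rightarrow>\<^sup>*\<^bsub>G\<^esub> v"
      by (simp only: reachable_mk_symmetric_eq[OF sym_arcs])
    then obtain p where "awalk w p v" by (auto simp: reachable_awalk)
    then show "v \<in> W"
      using assms(2)
    proof (induction p arbitrary: w)
      case Nil
      then show ?case by (simp add: awalk_Nil_iff)
    next
      case (Cons e p)
      then show ?case using assms(4) by (auto simp: awalk_Cons_iff)
    qed
  qed
  then show ?thesis using assms(3) by auto
qed

text \<open>
  A spanning tree \<open>T\<close> containing a spanning tree of the component of \<open>w\<close> in the subgraph \<open>S\<close>, whose vertex set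
  is \<open>W\<close>. As no vertex has valence one and \<open>S\<close> is a proper subgraph, some edge lies neither in this component
  nor in the tree. For suppose there is no such edge. If \<open>W\<close> contains all vertices, then \<open>T\<close> lies in \<open>S\<close>, and so
  does every edge. Otherwise the vertex that was added last has valence one.
\<close>

lemma adapted_spanning_tree:
  assumes fin: "finite (verts G)" and conn: "connected G" and val: "\<forall>v\<in>verts G. out_degree G v \<noteq> 1"
    and w: "w \<in> verts G" and S: "S \<subset> arcs G" "arev ` S \<subseteq> S"
  obtains T \<tau> W where "rooted_tree w (verts G) T \<tau>" "w \<in> W" "W \<subseteq> verts G"
    "\<And>e. e \<in> S \<Longrightarrow> tail G e \<in> W \<Longrightarrow> head G e \<in> W" "\<And>u. u \<in> W \<Longrightarrow> set (\<tau> u) \<subseteq> S"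
    "\<exists>e\<in>arcs G. e \<notin> T \<and> \<not> (e \<in> S \<and> tail G e \<in> W)"
proof -
  obtain W T0 \<tau>0 where 0: "rooted_tree w W T0 \<tau>0" "T0 \<subseteq> {} \<union> S"
      "\<forall>e\<in>S. tail G e \<in> W \<longrightarrow> head G e \<in> W"
    using rooted_tree_extend[OF fin root[OF w] psubset_imp_subset[OF S(1)] S(2)]
    by (elim exE conjE) (rule that; assumption)
  have arcs_closed: "arev ` arcs G \<subseteq> arcs G" by auto
  obtain W' T \<tau> where 1: "rooted_tree w W' T \<tau>" "W \<subseteq> W'" "\<forall>u\<in>W. \<tau> u = \<tau>0 u"
      "\<forall>e\<in>arcs G. tail G e \<in> W' \<longrightarrow> head G e \<in> W'"
      "W' = W \<and> T = T0 \<or> (\<exists>u\<in>W' - W. \<exists>a. {e\<in>T. tail G e = u} = {a})"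
    using rooted_tree_extend[OF fin 0(1) order_refl arcs_closed]
    by (elim exE conjE) (rule that; assumption)
  have W': "W' = verts G"
    using reachable_set_eq_verts[OF conn] rooted_treeD(1,2)[OF 1(1)] 1(4) by blast
  have "\<exists>e\<in>arcs G. e \<notin> T \<and> \<not> (e \<in> S \<and> tail G e \<in> W)"
  proof (rule ccontr)
    assume *: "\<not> ?thesis"
    show False
      using 1(5)
    proof (elim disjE bexE exE conjE)
      assume "T = T0"
      then show False using * 0(2) S by auto
    next
      fix u a assume u: "u \<in> W' - W" "{e\<in>T. tail G e = u} = {a}"
      then have "out_arcs G u = {a}"
        using * rooted_treeD(3)[OF 1(1)] by (auto simp: out_arcs_def)
      then show False using val u W' by (auto simp: out_degree_def)
    qed
  qed
  moreover have "set (\<tau> u) \<subseteq> S" if "u \<in> W" for u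
    using rooted_treeD(9)[OF 0(1) that] 1(3) 0(2) that by auto
  ultimately show thesis
    using that 0 1(1) W' rooted_treeD(1,2)[OF 0(1)] by metis
qed

end

text \<open>
  Reduced words under the action of words by left multiplication: a relation between words becomes an
  identity that the simplifier can apply at the head of any product.
\<close>

context involution begin

lemma foldr_homotopic:
  "homotopic iv p q \<Longrightarrow> reduced iv X \<Longrightarrow> foldr (cancel_cons iv) p X = foldr (cancel_cons iv) q X"
  by (metis foldr_reduce iv_iv)

lemma reduced_foldr_cancel_cons [simp]: "reduced iv X \<Longrightarrow> reduced iv (foldr (cancel_cons iv) p X)"
  by (rule reduced_foldr) simp_all

lemma reduced_reduce_word [simp]: "reduced iv (reduce iv p)"
  by (rule reduced_reduce) simp_all

lemma foldr_path_inv [simp]: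
  assumes "reduced iv X"
  shows "foldr (cancel_cons iv) (path_inv iv p) (foldr (cancel_cons iv) p X) = X"
    and "foldr (cancel_cons iv) p (foldr (cancel_cons iv) (path_inv iv p) X) = X"
proof -
  show 1: "foldr (cancel_cons iv) (path_inv iv p) (foldr (cancel_cons iv) p X) = X" for p
    unfolding path_inv_def by (rule foldr_rev_map) (use assms in simp_all)
  show "foldr (cancel_cons iv) p (foldr (cancel_cons iv) (path_inv iv p) X) = X"
    using 1[of "path_inv iv p"] by simp
qed

lemma reduce_append_foldr: "reduce iv (p @ q) = foldr (cancel_cons iv) p (reduce iv q)"
  by (rule reduce_append) simp

lemma path_inv_Cons: "path_inv iv (x # p) = path_inv iv p @ [iv x]"
  by (simp add: path_inv_def)

lemma reduced_Nil [simp]: "reduced iv []"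
  by (simp add: reduced_def)

end

section \<open>Free factors carried by subgraphs\<close>

text \<open>
  A finite connected graph without vertices of valence one, with an identification \<open>\<theta>\<close> of the free group with the
  fundamental group at \<open>w\<close>. The loop \<open>\<theta> x\<close> represents its class and need not be reduced.
\<close>

locale based_marking = bidirected_digraph \<Gamma> rv + group F
  for \<Gamma> :: "('v, 'e) pre_digraph" and rv :: "'e \<Rightarrow> 'e" and F :: "letter list monoid" (structure) +
  fixes r :: nat and w :: 'v and \<theta> :: "letter list \<Rightarrow> 'e list"
  assumes F: "F = free_group r"
    and finite_verts: "finite (verts \<Gamma>)"
    and connected: "connected \<Gamma>"
    and valence: "\<forall>v\<in>verts \<Gamma>. out_degree \<Gamma> v \<noteq> 1"
    and base: "w \<in> verts \<Gamma>"
    and \<theta>_loop: "x \<in> carrier F \<Longrightarrow> awalk w (\<theta> x) w"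
    and \<theta>_mult: "x \<in> carrier F \<Longrightarrow> y \<in> carrier F \<Longrightarrow> homotopic rv (\<theta> (x \<otimes> y)) (\<theta> x @ \<theta> y)"
    and \<theta>_inj: "x \<in> carrier F \<Longrightarrow> reduce rv (\<theta> x) = [] \<Longrightarrow> x = \<one>"
    and \<theta>_surj: "awalk w q w \<Longrightarrow> \<exists>x\<in>carrier F. homotopic rv (\<theta> x) q"
begin

lemma \<theta>_eq:
  assumes "x \<in> carrier F" "y \<in> carrier F" "homotopic rv (\<theta> x) (\<theta> y)" shows "x = y"
proof -
  let ?z = "x \<otimes> inv y"
  have z: "?z \<in> carrier F" "?z \<otimes> y = x" using assms(1,2) by (simp_all add: m_assoc)
  have "homotopic rv (\<theta> ?z @ \<theta> y) ([] @ \<theta> y)"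
    using \<theta>_mult[OF z(1) assms(2)] assms(3) by (simp add: z(2))
  from homotopic_cancel_right[OF this] have "reduce rv (\<theta> ?z) = []" by simp
  with \<theta>_inj[OF z(1)] have "?z = \<one>" by simp
  then show ?thesis using assms(1,2) inv_equality[of x "inv y"] by simp
qed

text \<open>
  Collapsing a spanning tree turns loops at \<open>w\<close> into words over the remaining edges, and these words
  make the fundamental group free. The tree is adapted to the component of \<open>w\<close> in \<open>S\<close>, so the
  loops in \<open>S\<close> form the subgroup spanned by the remaining edges of this component: a free factor.
\<close>

lemma reducible_of_invariant_loops:
  assumes S: "S \<subset> arcs \<Gamma>" "rv ` S \<subseteq> S"
    and q0: "awalk w q0 w" "set q0 \<subseteq> S" "reduce rv q0 \<noteq> []"
    and \<phi>: "\<phi> \<in> carrier (Out F)" "\<Psi> \<in> \<phi>"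
    and inv: "\<And>x q. x \<in> carrier F \<Longrightarrow> awalk w q w \<Longrightarrow> set q \<subseteq> S \<Longrightarrow> homotopic rv (\<theta> x) q \<Longrightarrow>
      \<exists>q'. awalk w q' w \<and> set q' \<subseteq> S \<and> homotopic rv (\<theta> (\<Psi> x)) q'"
  shows "reducible F \<phi>"
proof -
  obtain T \<tau> W where T: "rooted_tree w (verts \<Gamma>) T \<tau>" and W: "w \<in> W" "W \<subseteq> verts \<Gamma>"
      "\<And>e. e \<in> S \<Longrightarrow> tail \<Gamma> e \<in> W \<Longrightarrow> head \<Gamma> e \<in> W" "\<And>u. u \<in> W \<Longrightarrow> set (\<tau> u) \<subseteq> S"
    and outside: "\<exists>e\<in>arcs \<Gamma>. e \<notin> T \<and> \<not> (e \<in> S \<and> tail \<Gamma> e \<in> W)"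
    using adapted_spanning_tree[OF finite_verts connected valence base S] by blast
  note T = rooted_treeD[OF T]
  have rv_T: "rv e \<in> T \<longleftrightarrow> e \<in> T" for e using T(4) by (metis arev_arev image_subset_iff)
  have rv_S: "rv e \<in> S \<longleftrightarrow> e \<in> S" for e using S(2) by (metis arev_arev image_subset_iff)
  (* The word of a path in the edges outside the tree, and the loop at w through a given edge. *)
  define collapse where "collapse p = filter (\<lambda>e. e \<notin> T) p" for p
  define \<sigma> where "\<sigma> e = \<tau> (tail \<Gamma> e) @ [e] @ path_inv rv (\<tau> (head \<Gamma> e))" for e
  define \<Theta> where "\<Theta> x = reduce rv (collapse (\<theta> x))" for x
  let ?X = "arcs \<Gamma> - T" and ?Y = "{e \<in> S. tail \<Gamma> e \<in> W} - T"
  have collapse_append: "collapse (p @ q) = collapse p @ collapse q" for p q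
    by (simp add: collapse_def)
  have "collapse p = concat (map (\<lambda>e. if e \<in> T then [] else [e]) p)" for p
    by (induction p) (auto simp: collapse_def)
  then have collapse_homotopic: "homotopic rv (collapse p) (collapse q)" if "homotopic rv p q" for p q
    using homotopic_concat_map[OF involution_axioms that, of "\<lambda>e. if e \<in> T then [] else [e]"]
    by (simp add: rv_T path_inv_def)
  have \<sigma>_rv: "\<sigma> (rv e) = path_inv rv (\<sigma> e)" if "e \<in> arcs \<Gamma>" for e
    using that by (simp add: \<sigma>_def path_inv_Cons)
  have \<sigma>_loop: "awalk w (\<sigma> e) w" if "e \<in> arcs \<Gamma>" for e
    unfolding \<sigma>_def
    by (intro awalk_appendI[of w _ "tail \<Gamma> e"] awalk_appendI[of _ _ "head \<Gamma> e"] awalk_path_inv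
        T(8) arc_implies_awalk) (use that in auto)
  have collapse_\<sigma>: "collapse (\<sigma> e) = [e]" if "e \<in> ?X" for e
  proof -
    have "collapse (\<tau> u) = []" "collapse (path_inv rv (\<tau> u)) = []" if "u \<in> verts \<Gamma>" for u
      using T(9)[OF that] rv_T unfolding collapse_def by (auto simp: filter_empty_conv set_path_inv)
    then show ?thesis using that by (simp add: \<sigma>_def collapse_append) (simp add: collapse_def)
  qed
  (* Inserting the way back to w along the tree and out again after each edge: tree edges contribute trivial loops. *)
  have expand: "homotopic rv (\<tau> u @ p) (concat (map \<sigma> (collapse p)) @ \<tau> v)" if "awalk u p v" for u p v
    using that
  proof (induction p arbitrary: u)
    case Nil
    then show ?case by (simp add: awalk_Nil_iff collapse_def)
  next
    case (Cons e p)
    then have e: "e \<in> arcs \<Gamma>" "u = tail \<Gamma> e" "awalk (head \<Gamma> e) p v" by (simp_all add: awalk_Cons_iff)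
    note IH = Cons.IH[OF e(3)]
    show ?case
    proof (cases "e \<in> T")
      case True
      have "homotopic rv ((\<tau> u @ [e]) @ p) (\<tau> (head \<Gamma> e) @ p)"
        by (rule homotopic_append) (use T(10)[OF True] e(2) in simp_all)
      then show ?thesis using IH True by (simp add: collapse_def)
    next
      case False
      have "homotopic rv (\<sigma> e @ (\<tau> (head \<Gamma> e) @ p)) (\<sigma> e @ (concat (map \<sigma> (collapse p)) @ \<tau> v))"
        by (rule homotopic_append) (simp_all add: IH)
      moreover have "homotopic rv (\<sigma> e @ (\<tau> (head \<Gamma> e) @ p)) (\<tau> u @ e # p)"
        using homotopic_cancel_inner(1)[of "\<tau> u @ [e]" "\<tau> (head \<Gamma> e)" p] e by (simp add: \<sigma>_def)
      ultimately show ?thesis using False by (simp add: collapse_def)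
    qed
  qed
  have expand_\<Theta>: "homotopic rv (\<theta> x) (concat (map \<sigma> (\<Theta> x)))" if "x \<in> carrier F" for x
  proof -
    have "set (collapse (\<theta> x)) \<subseteq> arcs \<Gamma>"
      using \<theta>_loop[OF that] by (auto simp: collapse_def awalk_def)
    then have "homotopic rv (concat (map \<sigma> (\<Theta> x))) (concat (map \<sigma> (collapse (\<theta> x))))"
      unfolding \<Theta>_def by (intro reduce_concat_map_reduce involution_axioms \<sigma>_rv) auto
    then show ?thesis using expand[OF \<theta>_loop[OF that]] T(5) by simp
  qed
  have basis: "free_basis F rv ?X \<Theta>"
  proof (unfold_locales)
    show "rv e \<in> ?X" if "e \<in> ?X" for e using that rv_T by auto
    show "set (\<Theta> x) \<subseteq> ?X" if "x \<in> carrier F" for x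
      using \<theta>_loop[OF that] set_reduce_subset[of "collapse (\<theta> x)"]
      by (auto simp: \<Theta>_def collapse_def awalk_def)
    show "reduced rv (\<Theta> x)" for x by (simp add: \<Theta>_def)
    show "\<Theta> (x \<otimes> y) = reduce rv (\<Theta> x @ \<Theta> y)" if "x \<in> carrier F" "y \<in> carrier F" for x y
      using collapse_homotopic[OF \<theta>_mult[OF that]]
      by (simp add: \<Theta>_def collapse_append reduce_append_reduce)
    show "x = \<one>" if "x \<in> carrier F" "\<Theta> x = []" for x
      using expand_\<Theta>[OF that(1)] that by (intro \<theta>_inj) auto
    show "\<exists>x\<in>carrier F. \<Theta> x = [e]" if e: "e \<in> ?X" for e
    proof -
      obtain x where x: "x \<in> carrier F" "homotopic rv (\<theta> x) (\<sigma> e)" using \<theta>_surj[OF \<sigma>_loop[of e]] e by auto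
      have "\<Theta> x = reduce rv [e]"
        using collapse_homotopic[OF x(2)] collapse_\<sigma>[OF e] by (simp add: \<Theta>_def)
      then show ?thesis using x(1) by (auto simp: reduce_def cancel_cons_def)
    qed
  qed
  interpret B: free_basis F rv ?X \<Theta> by (rule basis)
  have in_component: "set q \<subseteq> {e \<in> S. tail \<Gamma> e \<in> W}" if "awalk u q v" "u \<in> W" "set q \<subseteq> S" for u q v
    using that
  proof (induction q arbitrary: u)
    case (Cons e q)
    then show ?case using W(3)[of e] by (auto simp: awalk_Cons_iff)
  qed simp
  have span_iff: "x \<in> B.span ?Y \<longleftrightarrow> (\<exists>q. awalk w q w \<and> set q \<subseteq> S \<and> homotopic rv (\<theta> x) q)"
    if x: "x \<in> carrier F" for x
  proof
    assume "x \<in> B.span ?Y"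
    then have Y: "set (\<Theta> x) \<subseteq> ?Y" by (simp add: B.span_def)
    have "set (\<sigma> e) \<subseteq> S" if "e \<in> ?Y" for e
      using that W(3)[of e] W(4)[of "tail \<Gamma> e"] W(4)[of "head \<Gamma> e"] rv_S
      by (auto simp: \<sigma>_def set_path_inv)
    then have 1: "set (concat (map \<sigma> (\<Theta> x))) \<subseteq> S" using Y by fastforce
    have "awalk w (concat (map \<sigma> l)) w" if "set l \<subseteq> arcs \<Gamma>" for l
      using that base
      by (induction l) (simp_all add: awalk_Nil_iff awalk_appendI[OF \<sigma>_loop] del: awalk_append_iff)
    moreover have "set (\<Theta> x) \<subseteq> arcs \<Gamma>" using Y S by auto
    ultimately show "\<exists>q. awalk w q w \<and> set q \<subseteq> S \<and> homotopic rv (\<theta> x) q"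
      using 1 expand_\<Theta>[OF x] by blast
  next
    assume "\<exists>q. awalk w q w \<and> set q \<subseteq> S \<and> homotopic rv (\<theta> x) q"
    then obtain q where q: "awalk w q w" "set q \<subseteq> S" "homotopic rv (\<theta> x) q" by blast
    have "\<Theta> x = reduce rv (collapse q)" unfolding \<Theta>_def by (rule collapse_homotopic[OF q(3)])
    then have "set (\<Theta> x) \<subseteq> set (collapse q)" using set_reduce_subset by simp
    also have "\<dots> \<subseteq> ?Y" using in_component[OF q(1) W(1) q(2)] by (auto simp: collapse_def)
    finally show "x \<in> B.span ?Y" using x by (simp add: B.span_def)
  qed
  have \<Psi>: "\<Psi> x \<in> carrier F" if "x \<in> carrier F" for x
    using mem_Out(1)[OF \<phi>] that by (auto simp: auto_def intro: hom_in_carrier)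
  show ?thesis
    unfolding F
  proof (rule reducible_of_invariant_span[where \<Theta> = \<Theta> and Y = ?Y and \<Psi> = \<Psi> and iv = rv])
    show "free_basis (free_group r) rv ?X \<Theta>" using basis by (simp add: F)
    show "\<phi> \<in> carrier (Out (free_group r))" "\<Psi> \<in> \<phi>" using \<phi> by (simp_all add: F)
    show "?Y \<subset> ?X" using outside S by auto
    obtain x where x: "x \<in> carrier F" "homotopic rv (\<theta> x) q0" using \<theta>_surj[OF q0(1)] by blast
    then have "x \<in> B.span ?Y" using span_iff q0 by blast
    moreover have "\<Theta> x \<noteq> []"
      using x expand_\<Theta>[OF x(1)] q0(3) by auto
    ultimately show "?Y \<noteq> {}" by (metis (no_types, lifting) B.span_def mem_Collect_eq set_empty subset_empty)
    have "tail \<Gamma> (rv e) \<in> W \<longleftrightarrow> tail \<Gamma> e \<in> W" if "e \<in> S" for e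
    proof -
      have "e \<in> arcs \<Gamma>" "rv e \<in> S" using that S rv_S by auto
      then show ?thesis using W(3)[OF that] W(3)[of "rv e"] by auto
    qed
    then show "rv e \<in> ?Y \<longleftrightarrow> e \<in> ?Y" for e
      using rv_S[of e] rv_T[of e] by blast
    have "\<Psi> x \<in> B.span ?Y" if x': "x \<in> B.span ?Y" for x
    proof -
      have x: "x \<in> carrier F" using x' by (simp add: B.span_def)
      then obtain q where "awalk w q w" "set q \<subseteq> S" "homotopic rv (\<theta> x) q"
        using x' span_iff[OF x] by blast
      from inv[OF x this] show ?thesis using span_iff[OF \<Psi>[OF x]] by simp
    qed
    then show "\<Psi> ` free_basis.span (free_group r) \<Theta> ?Y \<subseteq> free_basis.span (free_group r) \<Theta> ?Y"
      by (auto simp: F)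
  qed
qed

end

section \<open>Markings and iterates\<close>

lemma path_map_comp_map: "path_map (comp_map h f) p = path_map h (path_map f p)"
  by (induction p) (simp_all add: comp_map_def)

lemma path_map_id_map: "path_map id_map p = p"
  by (induction p) (simp_all add: id_map_def)

text \<open>The graph map that records the untightened images under the \<open>k\<close>-th iterate.\<close>

definition iterate_map :: "nat \<Rightarrow> ('v, 'e, 'v, 'e) graph_map \<Rightarrow> ('v, 'e, 'v, 'e) graph_map" where
  "iterate_map k f = \<lparr>vmap = vmap f ^^ k, emap = \<lambda>e. (path_map f ^^ k) [e]\<rparr>"

lemma funpow_path_map_append:
  fixes f :: "('v, 'e, 'v, 'e) graph_map"
  shows "(path_map f ^^ k) (p @ q) = (path_map f ^^ k) p @ (path_map f ^^ k) q"
  by (induction k) simp_all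

lemma funpow_path_map_Nil [simp]:
  fixes f :: "('v, 'e, 'v, 'e) graph_map"
  shows "(path_map f ^^ k) [] = []"
  by (induction k) simp_all

lemma path_map_iterate_map: "path_map (iterate_map k f) p = (path_map f ^^ k) p"
proof (induction p)
  case (Cons e p)
  then show ?case
    using funpow_path_map_append[of k f "[e]" p] by (simp add: iterate_map_def)
qed simp

lemma (in bidirected_digraph) is_graph_map_iterate:
  assumes "is_graph_map G arev G arev f"
  shows "is_graph_map G arev G arev (iterate_map k f)"
proof (induction k)
  case 0
  then show ?case
    by (auto simp: is_graph_map_def iterate_map_def path_inv_def arc_implies_awalk)
next
  case (Suc k)
  have "awalk (vmap f (vmap (iterate_map k f) (tail G e))) (path_map f (emap (iterate_map k f) e))
      (vmap f (vmap (iterate_map k f) (head G e)))" if "e \<in> arcs G" for e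
    by (rule awalk_path_map[OF assms bidirected_digraph]) (use Suc that in \<open>auto simp: is_graph_map_def\<close>)
  moreover have "path_map f (emap (iterate_map k f) (arev e)) = path_inv arev (path_map f (emap (iterate_map k f) e))"
    if "e \<in> arcs G" for e
  proof -
    have "set (emap (iterate_map k f) e) \<subseteq> arcs G"
      using Suc that by (auto simp: is_graph_map_def awalk_def)
    then show ?thesis
      using Suc that path_map_path_inv[OF assms bidirected_digraph] by (auto simp: is_graph_map_def)
  qed
  ultimately show ?case
    using Suc assms by (auto simp: is_graph_map_def iterate_map_def)
qed

lemma (in bidirected_digraph) homotopic_id_mapD:
  assumes "map_homotopic G G arev (comp_map h f) id_map"
  shows "\<exists>P. (\<forall>v\<in>verts G. awalk (vmap h (vmap f v)) (P v) v) \<and>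
    (\<forall>u p v. awalk u p v \<longrightarrow> homotopic arev (path_map h (path_map f p) @ P v) (P u @ p))"
  using map_homotopicD[OF assms bidirected_digraph]
  by (simp add: path_map_comp_map path_map_id_map) (simp add: comp_map_def id_map_def)

lemma rose_awalk: "pre_digraph.awalk (rose r) u p v \<longleftrightarrow> set p \<subseteq> letters r"
proof -
  have "pre_digraph.cas (rose r) u p v" by (induction p arbitrary: u) (auto simp: pre_digraph.cas.simps)
  then show ?thesis by (auto simp: pre_digraph.awalk_def rose_def)
qed

lemma reduce_rose_rev: "set p \<subseteq> letters r \<Longrightarrow> reduce (rose_rev r) p = reduce letter_inv p"
  by (rule reduce_cong) (auto simp: rose_rev_def)

text \<open>
  A marking identifies the free group with the fundamental group based at any vertex \<open>w\<close>. The path to \<open>w\<close>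
  is the track of \<open>w\<close> under a homotopy from \<open>m \<circ> m'\<close> to the identity, where \<open>m'\<close> is a homotopy inverse of \<open>m\<close>;
  with this choice the homotopy shows surjectivity directly.
\<close>

lemma marking_based:
  assumes "marked_graph r \<Gamma> rv m" "w \<in> verts \<Gamma>"
  obtains \<delta> where "edge_path \<Gamma> (vmap m ()) \<delta> w"
    "based_marking \<Gamma> rv (free_group r) r w (\<lambda>x. path_inv rv \<delta> @ path_map m x @ \<delta>)"
proof -
  from assms(1) have fin: "fin_digraph \<Gamma>" and bi: "bidirected_digraph \<Gamma> rv" and conn: "connected \<Gamma>"
    and val: "\<forall>v\<in>verts \<Gamma>. out_degree \<Gamma> v \<noteq> 1"
    and equiv: "homotopy_equiv (rose r) (rose_rev r) \<Gamma> rv m"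
    by (auto simp: marked_graph_def)
  interpret bidirected_digraph \<Gamma> rv by (rule bi)
  interpret R: bidirected_digraph "rose r" "rose_rev r" by (rule bidirected_digraph_rose)
  let ?F = "free_group r"
  interpret F: group ?F by (rule group_free_group)
  from equiv obtain m' where m: "is_graph_map (rose r) (rose_rev r) \<Gamma> rv m"
      and m': "is_graph_map \<Gamma> rv (rose r) (rose_rev r) m'"
      and mm': "map_homotopic (rose r) (rose r) (rose_rev r) (comp_map m' m) id_map"
      and m'm: "map_homotopic \<Gamma> \<Gamma> rv (comp_map m m') id_map"
    by (auto simp: homotopy_equiv_def)
  from R.homotopic_id_mapD[OF mm'] obtain P where P: "\<forall>u p v. R.awalk u p v \<longrightarrow>
      homotopic (rose_rev r) (path_map m' (path_map m p) @ P v) (P u @ p)"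
    by (elim exE conjE) (rule that; assumption)
  from homotopic_id_mapD[OF m'm] obtain Q
    where Q1: "\<forall>v\<in>verts \<Gamma>. awalk (vmap m (vmap m' v)) (Q v) v"
      and Q2: "\<forall>u p v. awalk u p v \<longrightarrow>
        homotopic rv (path_map m (path_map m' p) @ Q v) (Q u @ p)"
    by (elim exE conjE) (rule that; assumption)
  have \<delta>: "awalk (vmap m ()) (Q w) w"
    using Q1 assms(2) by simp
  have rose_arcs: "arcs (rose r) = letters r" by (simp add: rose_def)
  have carrier: "set x \<subseteq> letters r" "reduce letter_inv x = x" if "x \<in> carrier ?F" for x
    using that by (auto simp: free_group_carrier reduce_id)
  let ?\<theta> = "\<lambda>x. path_inv rv (Q w) @ path_map m x @ Q w"
  have m_loop: "awalk (vmap m ()) (path_map m x) (vmap m ())" if "set x \<subseteq> letters r" for x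
    using R.awalk_path_map[OF m bi, of "()" x "()"] that by (simp add: rose_awalk)
  have "based_marking \<Gamma> rv ?F r w ?\<theta>"
  proof (unfold_locales)
    show "finite (verts \<Gamma>)" using fin by (simp add: fin_digraph.finite_verts)
    show "awalk w (?\<theta> x) w" if "x \<in> carrier ?F" for x
      using awalk_path_inv[OF \<delta>] m_loop[of x] \<delta> carrier[OF that] by (blast intro: awalk_appendI)
    show "homotopic rv (?\<theta> (x \<otimes>\<^bsub>?F\<^esub> y)) (?\<theta> x @ ?\<theta> y)" if "x \<in> carrier ?F" "y \<in> carrier ?F" for x y
    proof -
      have xy: "set (x @ y) \<subseteq> letters r" using that carrier by auto
      have "homotopic rv (path_map m (reduce (rose_rev r) (x @ y))) (path_map m (x @ y))"
        by (rule R.homotopic_path_map[OF m bi])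
          (use xy R.set_reduce_subset[of "x @ y"] in \<open>auto simp: rose_arcs\<close>)
      then have "homotopic rv (path_map m (x \<otimes>\<^bsub>?F\<^esub> y)) (path_map m x @ path_map m y)"
        by (simp add: free_group_mult reduce_rose_rev[OF xy, simplified])
      from foldr_homotopic[OF this] show ?thesis
        by (simp add: reduce_append_foldr)
    qed
    show "x = \<one>\<^bsub>?F\<^esub>" if x: "x \<in> carrier ?F" "reduce rv (?\<theta> x) = []" for x
    proof -
      have "homotopic rv (path_inv rv (Q w) @ path_map m x @ Q w) (path_inv rv (Q w) @ Q w)"
        using x(2) reduce_path_inv_left by simp
      from homotopic_cancel_left[OF this] have "homotopic rv (path_map m x @ Q w) ([] @ Q w)"
        by simp
      then have "homotopic rv (path_map m x) []" by (rule homotopic_cancel_right)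
      then have "homotopic (rose_rev r) (path_map m' (path_map m x)) (path_map m' [])"
        using m_loop[of x] carrier[OF x(1)]
        by (intro homotopic_path_map[OF m' bidirected_digraph_rose]) (auto simp: awalk_def)
      then have "homotopic (rose_rev r) (path_map m' (path_map m x) @ P ()) ([] @ P ())"
        by (intro R.homotopic_append) auto
      moreover have "homotopic (rose_rev r) (path_map m' (path_map m x) @ P ()) (P () @ x)"
        using P carrier[OF x(1)] by (simp add: rose_awalk)
      ultimately have "homotopic (rose_rev r) (P () @ x) (P () @ [])" by simp
      then have "homotopic (rose_rev r) x []" by (rule R.homotopic_cancel_left)
      then show ?thesis using carrier[OF x(1)] by (simp add: reduce_rose_rev free_group_one)
    qed
    show "\<exists>x\<in>carrier ?F. homotopic rv (?\<theta> x) q" if q: "awalk w q w" for q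
    proof -
      let ?y = "path_map m' q" and ?x = "reduce letter_inv (path_map m' q)"
      have y: "set ?y \<subseteq> letters r"
        using awalk_path_map[OF m' bidirected_digraph_rose q] by (simp add: rose_awalk)
      interpret L: involution letter_inv by (rule involution_letter_inv)
      have x: "?x \<in> carrier ?F"
        using y L.set_reduce_subset[of ?y] by (auto simp: free_group_carrier)
      have "homotopic rv (path_map m (reduce (rose_rev r) ?y)) (path_map m ?y)"
        by (rule R.homotopic_path_map[OF m bi])
          (use y R.set_reduce_subset[of ?y] in \<open>auto simp: rose_arcs\<close>)
      then have 1: "homotopic rv (path_map m ?x) (path_map m ?y)"
        by (simp add: reduce_rose_rev[OF y])
      have "homotopic rv (?\<theta> ?x) (path_inv rv (Q w) @ (path_map m ?y @ Q w))"
        by (intro homotopic_append HOL.refl 1)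
      moreover have "homotopic rv (path_inv rv (Q w) @ (path_map m ?y @ Q w)) (path_inv rv (Q w) @ (Q w @ q))"
        by (rule homotopic_append) (simp_all add: Q2 q)
      moreover have "homotopic rv (path_inv rv (Q w) @ (Q w @ q)) q"
        using homotopic_cancel_inner(1)[of "[]" "Q w" q] by simp
      ultimately show ?thesis using x by auto
    qed
  qed (use assms conn val in auto)
  then show thesis using \<delta> that by blast
qed

section \<open>Train tracks\<close>

text \<open>A train track representative \<open>g\<close> of a fully irreducible outer automorphism \<open>\<phi>\<close> of a free group of rank at least two.\<close>

locale train_track =
  fixes r :: nat and \<Gamma> :: "('v, 'e) pre_digraph" and rv :: "'e \<Rightarrow> 'e"
    and m :: "(unit, letter, 'v, 'e) graph_map" and g :: "('v, 'e, 'v, 'e) graph_map"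
    and \<phi> :: "(letter list \<Rightarrow> letter list) set"
  assumes r: "r \<ge> 2"
    and \<phi>: "\<phi> \<in> carrier (Out (free_group r))"
    and irreducible: "fully_irreducible (free_group r) \<phi>"
    and marked: "marked_graph r \<Gamma> rv m"
    and rep: "train_track_rep r \<Gamma> rv m g \<phi>"
begin

sublocale fin_digraph \<Gamma>
  using marked by (simp add: marked_graph_def)

sublocale bidirected_digraph \<Gamma> rv
  using marked by (simp add: marked_graph_def)

sublocale F: group "free_group r"
  by (rule group_free_group)

abbreviation F where "F \<equiv> free_group r"

text \<open>The iterates of \<open>g\<close> on edge paths, without tightening, and on vertices.\<close>

abbreviation gk :: "nat \<Rightarrow> 'e list \<Rightarrow> 'e list" where
  "gk k \<equiv> path_map g ^^ k"

abbreviation gv :: "nat \<Rightarrow> 'v \<Rightarrow> 'v" where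
  "gv k \<equiv> vmap g ^^ k"

lemma graph_map_g: "is_graph_map \<Gamma> rv \<Gamma> rv g"
  using rep by (simp add: train_track_rep_def homotopy_equiv_def)

lemma graph_map_gk: "is_graph_map \<Gamma> rv \<Gamma> rv (iterate_map k g)"
  by (rule is_graph_map_iterate[OF graph_map_g])

lemmas gk_append = funpow_path_map_append[of _ g]

lemma awalk_gk: "awalk u p v \<Longrightarrow> awalk (gv k u) (gk k p) (gv k v)"
  using awalk_path_map[OF graph_map_gk bidirected_digraph, of u p v k]
  by (simp add: path_map_iterate_map) (simp add: iterate_map_def)

lemma gk_path_inv: "set p \<subseteq> arcs \<Gamma> \<Longrightarrow> gk k (path_inv rv p) = path_inv rv (gk k p)"
  using path_map_path_inv[OF graph_map_gk bidirected_digraph] by (simp add: path_map_iterate_map)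

lemma gk_homotopic:
  "homotopic rv p q \<Longrightarrow> set p \<subseteq> arcs \<Gamma> \<Longrightarrow> set q \<subseteq> arcs \<Gamma> \<Longrightarrow> homotopic rv (gk k p) (gk k q)"
  using homotopic_path_map[OF graph_map_gk bidirected_digraph, of p q k] by (simp add: path_map_iterate_map)

lemma gk_arcs: "set p \<subseteq> arcs \<Gamma> \<Longrightarrow> set (gk k p) \<subseteq> arcs \<Gamma>"
  using set_path_map[OF graph_map_gk bidirected_digraph, of p k] by (simp add: path_map_iterate_map)

lemma gk_reduced: "e \<in> arcs \<Gamma> \<Longrightarrow> reduced rv (gk k [e])"
  using rep by (cases "k = 0") (auto simp: train_track_rep_def reduced_def)

lemma gk_add: "gk (j + k) p = gk j (gk k p)"
  by (simp add: funpow_add)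

lemma gv_verts: "v \<in> verts \<Gamma> \<Longrightarrow> gv k v \<in> verts \<Gamma>"
  by (induction k) (use graph_map_g in \<open>auto simp: is_graph_map_def\<close>)

text \<open>The iterates are injective on the fundamental group.\<close>

lemma gk_inj:
  assumes "awalk u p u" "reduce rv (gk k p) = []" shows "reduce rv p = []"
  using assms
proof (induction k arbitrary: u p)
  case (Suc k)
  from rep obtain h where h: "is_graph_map \<Gamma> rv \<Gamma> rv h" "map_homotopic \<Gamma> \<Gamma> rv (comp_map h g) id_map"
    by (auto simp: train_track_rep_def homotopy_equiv_def)
  let ?q = "gk k p"
  have q: "awalk (gv k u) ?q (gv k u)" by (rule awalk_gk[OF Suc.prems(1)])
  have gq: "awalk (gv (Suc k) u) (path_map g ?q) (gv (Suc k) u)" using awalk_gk[OF Suc.prems(1), of "Suc k"] by simp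
  from homotopic_id_mapD[OF h(2)] obtain P where "\<forall>u p v. awalk u p v \<longrightarrow>
      homotopic rv (path_map h (path_map g p) @ P v) (P u @ p)"
    by (elim exE conjE) (rule that; assumption)
  then have "homotopic rv (path_map h (path_map g ?q) @ P (gv k u)) (P (gv k u) @ ?q)"
    using q by simp
  moreover have "homotopic rv (path_map h (path_map g ?q)) (path_map h [])"
    using Suc.prems(2) gq by (intro homotopic_path_map[OF h(1) bidirected_digraph]) (auto simp: awalk_def)
  then have "homotopic rv (path_map h (path_map g ?q) @ P (gv k u)) ([] @ P (gv k u))"
    by (intro homotopic_append) auto
  ultimately have "homotopic rv (P (gv k u) @ ?q) (P (gv k u) @ [])" by simp
  then have "homotopic rv ?q []" by (rule homotopic_cancel_left)
  then show ?case using Suc.IH[OF Suc.prems(1)] by simp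
qed simp

text \<open>The iterate \<open>g\<^sup>n\<close> induces \<open>\<phi>\<^sup>n\<close>.\<close>

lemma induces_pow:
  "\<exists>\<Phi>\<in>\<phi> [^]\<^bsub>Out F\<^esub> n. \<exists>p. awalk (vmap m ()) p (gv n (vmap m ())) \<and>
    (\<forall>x\<in>carrier F. homotopic rv (gk n (path_map m x)) (path_inv rv p @ path_map m (\<Phi> x) @ p))"
proof (induction n)
  case 0
  have m0: "vmap m () \<in> verts \<Gamma>"
    using marked by (auto simp: marked_graph_def homotopy_equiv_def is_graph_map_def rose_def)
  show ?case
    by (rule bexI[OF _ F.id_mem_Out_pow], rule exI[of _ "[]"]) (use m0 in \<open>auto simp: awalk_Nil_iff\<close>)
next
  case (Suc n)
  then obtain \<Phi> p where \<Phi>: "\<Phi> \<in> \<phi> [^]\<^bsub>Out F\<^esub> n" and p: "awalk (vmap m ()) p (gv n (vmap m ()))"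
    "\<And>x. x \<in> carrier F \<Longrightarrow> homotopic rv (gk n (path_map m x)) (path_inv rv p @ path_map m (\<Phi> x) @ p)"
    by blast
  from rep obtain \<Phi>1 p1 where \<Phi>1: "\<Phi>1 \<in> \<phi>" and p1: "awalk (vmap m ()) p1 (vmap g (vmap m ()))"
    "\<And>x. x \<in> carrier F \<Longrightarrow> path_homotopic \<Gamma> rv (path_map g (path_map m x)) (path_inv rv p1 @ path_map m (\<Phi>1 x) @ p1)"
    by (auto simp: train_track_rep_def induces_def)
  have m: "is_graph_map (rose r) (rose_rev r) \<Gamma> rv m"
    using marked by (simp add: marked_graph_def homotopy_equiv_def)
  have m_arcs: "set (path_map m x) \<subseteq> arcs \<Gamma>" if "x \<in> carrier F" for x
    using bidirected_digraph.set_path_map[OF bidirected_digraph_rose m bidirected_digraph, of x] that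
    by (auto simp: free_group_carrier rose_def)
  have \<Phi>1_carrier: "\<Phi>1 x \<in> carrier F" if "x \<in> carrier F" for x
    using F.mem_Out(1)[OF \<phi> \<Phi>1] that by (auto simp: auto_def intro: hom_in_carrier)
  have p1_arcs: "set p1 \<subseteq> arcs \<Gamma>" using p1 by (auto simp: awalk_def)
  show ?case
  proof (intro bexI[of _ "compose (carrier F) \<Phi> \<Phi>1"] exI[of _ "p @ gk n p1"] conjI ballI)
    have "awalk (gv n (vmap m ())) (gk n p1) (gv (Suc n) (vmap m ()))"
      using awalk_gk[OF p1(1), of n] by (simp add: funpow_swap1)
    then show "awalk (vmap m ()) (p @ gk n p1) (gv (Suc n) (vmap m ()))"
      using p(1) by (blast intro: awalk_appendI)
    show "compose (carrier F) \<Phi> \<Phi>1 \<in> \<phi> [^]\<^bsub>Out F\<^esub> Suc n"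
      by (rule F.compose_mem_Out_pow[OF \<phi> \<Phi> \<Phi>1])
    fix x assume x: "x \<in> carrier F"
    have "homotopic rv (gk n (path_map g (path_map m x))) (gk n (path_inv rv p1 @ path_map m (\<Phi>1 x) @ p1))"
      using homotopic_of_path_homotopic[OF p1(2)[OF x]] m_arcs[OF x] m_arcs[OF \<Phi>1_carrier[OF x]] p1_arcs
        gk_arcs[OF m_arcs[OF x], of 1]
      by (intro gk_homotopic) (auto simp: set_path_inv)
    moreover have "gk (Suc n) (path_map m x) = gk n (path_map g (path_map m x))"
      by (simp add: funpow_swap1)
    ultimately show "homotopic rv (gk (Suc n) (path_map m x))
        (path_inv rv (p @ gk n p1) @ path_map m (compose (carrier F) \<Phi> \<Phi>1 x) @ (p @ gk n p1))"
      using x foldr_homotopic[OF p(2)[OF \<Phi>1_carrier[OF x]]]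
      by (simp add: gk_append gk_path_inv[OF p1_arcs] reduce_append_foldr compose_def)
  qed
qed

text \<open>
  At a vertex \<open>w\<close> fixed by \<open>g\<^sup>n\<close>, the action of \<open>g\<^sup>n\<close> on loops is an automorphism in the class
  \<open>\<phi>\<^sup>n\<close>.
\<close>

lemma fixed_vertex_action:
  assumes "w \<in> verts \<Gamma>" "gv n w = w"
  obtains \<theta> \<Psi> where "based_marking \<Gamma> rv F r w \<theta>" "\<Psi> \<in> \<phi> [^]\<^bsub>Out F\<^esub> n"
    "\<And>x. x \<in> carrier F \<Longrightarrow> homotopic rv (\<theta> (\<Psi> x)) (gk n (\<theta> x))"
proof -
  obtain \<delta> where \<delta>: "awalk (vmap m ()) \<delta> w"
    and based: "based_marking \<Gamma> rv F r w (\<lambda>x. path_inv rv \<delta> @ path_map m x @ \<delta>)"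
    by (rule marking_based[OF marked assms(1)])
  define \<theta> where "\<theta> x = path_inv rv \<delta> @ path_map m x @ \<delta>" for x
  interpret B: based_marking \<Gamma> rv F r w \<theta>
    using based by (simp add: \<theta>_def[abs_def])
  obtain \<Phi> p where \<Phi>: "\<Phi> \<in> \<phi> [^]\<^bsub>Out F\<^esub> n" and p: "awalk (vmap m ()) p (gv n (vmap m ()))"
    "\<And>x. x \<in> carrier F \<Longrightarrow> homotopic rv (gk n (path_map m x)) (path_inv rv p @ path_map m (\<Phi> x) @ p)"
    using induces_pow[of n] by blast
  interpret O: group "Out F" by (rule F.group_Out)
  have \<phi>n: "\<phi> [^]\<^bsub>Out F\<^esub> n \<in> carrier (Out F)" using \<phi> by simp
  have \<Phi>_carrier: "\<Phi> x \<in> carrier F" if "x \<in> carrier F" for x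
    using F.mem_Out(1)[OF \<phi>n \<Phi>] that by (auto simp: auto_def intro: hom_in_carrier)
  have "awalk (gv n (vmap m ())) (gk n \<delta>) w" using awalk_gk[OF \<delta>, of n] assms(2) by simp
  then have "awalk w (path_inv rv \<delta> @ p @ gk n \<delta>) w"
    using awalk_path_inv[OF \<delta>] p(1) by (blast intro: awalk_appendI)
  (* The loop that compares moving the base point with applying g^n; conjugation by it corrects the automorphism. *)
  then obtain z where z: "z \<in> carrier F" "homotopic rv (\<theta> z) (path_inv rv \<delta> @ p @ gk n \<delta>)"
    using B.\<theta>_surj by blast
  define \<Psi> where "\<Psi> = compose (carrier F) (\<lambda>x\<in>carrier F. inv\<^bsub>F\<^esub> z \<otimes>\<^bsub>F\<^esub> x \<otimes>\<^bsub>F\<^esub> inv\<^bsub>F\<^esub> (inv\<^bsub>F\<^esub> z)) \<Phi>"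
  have \<Psi>: "\<Psi> \<in> \<phi> [^]\<^bsub>Out F\<^esub> n"
    unfolding \<Psi>_def by (subst F.mem_Out(2)[OF \<phi>n \<Phi>]) (use F.inv_closed[OF z(1)] in blast)
  have "homotopic rv (\<theta> (\<Psi> x)) (gk n (\<theta> x))" if x: "x \<in> carrier F" for x
  proof (rule homotopic_cancel_left)
    have \<Psi>x: "\<Psi> x \<in> carrier F" "z \<otimes>\<^bsub>F\<^esub> \<Psi> x = \<Phi> x \<otimes>\<^bsub>F\<^esub> z"
      using x z(1) \<Phi>_carrier[OF x] by (simp_all add: \<Psi>_def compose_def F.m_assoc[symmetric])
    have \<delta>_arcs: "set \<delta> \<subseteq> arcs \<Gamma>" using \<delta> by (auto simp: awalk_def)
    have "homotopic rv (\<theta> z @ \<theta> (\<Psi> x)) (\<theta> (\<Phi> x) @ \<theta> z)"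
      using B.\<theta>_mult[OF z(1) \<Psi>x(1)] B.\<theta>_mult[OF \<Phi>_carrier[OF x] z(1)] \<Psi>x(2) by simp
    also have "homotopic rv (\<theta> (\<Phi> x) @ \<theta> z) (\<theta> (\<Phi> x) @ (path_inv rv \<delta> @ p @ gk n \<delta>))"
      by (rule homotopic_append) (simp_all add: z(2))
    also have "homotopic rv (\<theta> (\<Phi> x) @ (path_inv rv \<delta> @ p @ gk n \<delta>))
        ((path_inv rv \<delta> @ p @ gk n \<delta>) @ gk n (\<theta> x))"
      using foldr_homotopic[OF p(2)[OF x]]
      by (simp add: \<theta>_def gk_append gk_path_inv[OF \<delta>_arcs] reduce_append_foldr)
    also have "homotopic rv ((path_inv rv \<delta> @ p @ gk n \<delta>) @ gk n (\<theta> x)) (\<theta> z @ gk n (\<theta> x))"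
      by (rule homotopic_append) (simp_all add: z(2))
    finally show "homotopic rv (\<theta> z @ \<theta> (\<Psi> x)) (\<theta> z @ gk n (\<theta> x))" .
  qed
  then show thesis using that B.based_marking_axioms \<Psi> by blast
qed

end

section \<open>Invariant subgraphs are forests\<close>

lemma eventually_periodic:
  fixes f :: "nat \<Rightarrow> 'x"
  assumes "finite A" "\<And>k. f k \<in> A"
  obtains j n where "n > 0" "f (j + n) = f j"
proof -
  have "\<not> inj f"
    using assms by (metis finite_imageD finite_subset image_subsetI infinite_UNIV_nat)
  then obtain a b where "f a = f b" "a < b"
    by (auto simp: inj_def) (metis nat_neq_iff)
  then show thesis using that[of "b - a" a] by simp
qed

lemma filter_length_ge_blocks:
  assumes "L > 0" "\<And>u v z. w = u @ v @ z \<Longrightarrow> length v = L \<Longrightarrow> \<exists>x\<in>set v. P x" "length w \<ge> L * n"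
  shows "length (filter P w) \<ge> n"
  using assms(2,3)
proof (induction n arbitrary: w)
  case (Suc n)
  have "n \<le> length (filter P (drop L w))"
  proof (rule Suc.IH)
    show "\<exists>x\<in>set v. P x" if "drop L w = u @ v @ z" "length v = L" for u v z
      using Suc.prems(1)[of "take L w @ u" v z] that by (metis append.assoc append_take_drop_id)
    show "L * n \<le> length (drop L w)" using Suc.prems(2) by simp
  qed
  moreover have "\<exists>x\<in>set (take L w). P x"
    using Suc.prems(1)[of "[]" "take L w" "drop L w"] Suc.prems(2) by simp
  then have "filter P (take L w) \<noteq> []" by (auto simp: filter_empty_conv)
  then have "1 \<le> length (filter P (take L w))" by (simp add: Suc_le_eq)
  moreover have "filter P w = filter P (take L w) @ filter P (drop L w)"
    by (metis append_take_drop_id filter_append)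
  ultimately show ?case by simp
qed simp

lemma not_distinct_filter_decomp:
  assumes "\<not> distinct (filter P w)"
  obtains c u v z where "P c" "w = u @ c # v @ c # z"
proof -
  have "\<exists>c u v z. P c \<and> w = u @ c # v @ c # z"
    using assms
  proof (induction w)
    case (Cons a w)
    show ?case
    proof (cases "distinct (filter P w)")
      case True
      then have "P a" "a \<in> set w" using Cons.prems by (auto split: if_splits)
      then obtain v z where "w = v @ a # z" by (auto dest: split_list)
      then have "a # w = [] @ a # v @ a # z" by simp
      then show ?thesis using \<open>P a\<close> by blast
    next
      case False
      then obtain c u v z where "P c" "w = u @ c # v @ c # z" using Cons.IH by blast
      then have "a # w = (a # u) @ c # v @ c # z" by simp
      then show ?thesis using \<open>P c\<close> by blast
    qed
  qed simp
  then show thesis using that by blast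
qed

context train_track begin

lemma not_reducible: "n > 0 \<Longrightarrow> \<not> reducible F (\<phi> [^]\<^bsub>Out F\<^esub> (n::nat))"
  using irreducible by (simp add: fully_irreducible_def irreducible_out_def)

lemma \<phi>_pow: "\<phi> [^]\<^bsub>Out F\<^esub> (n::nat) \<in> carrier (Out F)"
proof -
  interpret O: group "Out F" by (rule F.group_Out)
  show ?thesis using \<phi> by simp
qed

lemma set_gk: "set (gk k p) = (\<Union>e\<in>set p. set (gk k [e]))"
proof (induction p)
  case (Cons e p)
  then show ?case using gk_append[of k "[e]" p] by simp
qed simp

lemma gk_invariant:
  assumes "\<And>e. e \<in> S \<Longrightarrow> set (gk i [e]) \<subseteq> S" "set p \<subseteq> S" shows "set (gk (i * k) p) \<subseteq> S"
proof (induction k)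
  case (Suc k)
  have "gk (i * Suc k) p = gk i (gk (i * k) p)" by (simp add: gk_add)
  then show ?case using Suc assms(1) set_gk[of i "gk (i * k) p"] by auto
qed (use assms in simp)

text \<open>
  A proper subgraph that is invariant under some iterate is a forest. Otherwise, an essential loop in it is carried by
  iteration to an essential loop at a periodic vertex \<open>w\<close>, and the loops at \<open>w\<close> in the subgraph form a proper
  nontrivial free factor that a power of \<open>\<phi>\<close> preserves.
\<close>

lemma invariant_subgraph_no_loop:
  assumes S: "S \<subset> arcs \<Gamma>" "rv ` S \<subseteq> S" and i: "i > 0" and inv: "\<And>e. e \<in> S \<Longrightarrow> set (gk i [e]) \<subseteq> S"
    and q: "awalk v q v" "set q \<subseteq> S"
  shows "reduce rv q = []"
proof (rule ccontr)
  assume ess: "reduce rv q \<noteq> []"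
  have "v \<in> verts \<Gamma>" using q(1) by (rule awalk_hd_in_verts)
  then have "gv (i * k) v \<in> verts \<Gamma>" for k by (rule gv_verts)
  with finite_verts obtain j n where n: "n > 0" "gv (i * (j + n)) v = gv (i * j) v"
    by (rule eventually_periodic[of "verts \<Gamma>" "\<lambda>k. gv (i * k) v"])
  let ?w = "gv (i * j) v" and ?N = "i * n" and ?q = "gk (i * j) q"
  have w_fix: "gv ?N ?w = ?w"
  proof -
    have "gv ?N ?w = gv (?N + i * j) v" by (simp only: funpow_add comp_apply)
    also have "?N + i * j = i * (j + n)" by (simp add: algebra_simps)
    finally show ?thesis using n(2) by simp
  qed
  have w: "?w \<in> verts \<Gamma>" using \<open>v \<in> verts \<Gamma>\<close> by (rule gv_verts)
  obtain \<theta> \<Psi> where based: "based_marking \<Gamma> rv F r ?w \<theta>" and \<Psi>: "\<Psi> \<in> \<phi> [^]\<^bsub>Out F\<^esub> ?N"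
    and act: "\<And>x. x \<in> carrier F \<Longrightarrow> homotopic rv (\<theta> (\<Psi> x)) (gk ?N (\<theta> x))"
    by (rule fixed_vertex_action[OF w w_fix]) blast
  interpret B: based_marking \<Gamma> rv F r ?w \<theta> by (rule based)
  have "reducible F (\<phi> [^]\<^bsub>Out F\<^esub> ?N)"
  proof (rule B.reducible_of_invariant_loops[OF S _ _ _ \<phi>_pow \<Psi>])
    show "awalk ?w ?q ?w" by (rule awalk_gk[OF q(1)])
    show "set ?q \<subseteq> S" by (rule gk_invariant[OF inv q(2)])
    show "reduce rv ?q \<noteq> []" using gk_inj[OF q(1)] ess by blast
    fix x p assume x: "x \<in> carrier F" and p: "awalk ?w p ?w" "set p \<subseteq> S" "homotopic rv (\<theta> x) p"
    have "homotopic rv (gk ?N (\<theta> x)) (gk ?N p)"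
      using p B.\<theta>_loop[OF x] by (intro gk_homotopic) (auto simp: awalk_def)
    then have "homotopic rv (\<theta> (\<Psi> x)) (gk ?N p)" using act[OF x] by simp
    moreover have "awalk ?w (gk ?N p) ?w" using awalk_gk[OF p(1), of ?N] w_fix by simp
    moreover have "set (gk ?N p) \<subseteq> S" by (rule gk_invariant[OF inv p(2)])
    ultimately show "\<exists>p'. awalk ?w p' ?w \<and> set p' \<subseteq> S \<and> homotopic rv (\<theta> (\<Psi> x)) p'" by blast
  qed
  then show False using not_reducible[of ?N] i n(1) by simp
qed

text \<open>A reduced path that repeats an edge contains a nonempty reduced loop, so a forest has none.\<close>

lemma invariant_subgraph_path_distinct:
  assumes S: "S \<subset> arcs \<Gamma>" "rv ` S \<subseteq> S" "i > 0" "\<And>e. e \<in> S \<Longrightarrow> set (gk i [e]) \<subseteq> S"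
    and p: "awalk u p v" "set p \<subseteq> S" "reduced rv p"
  shows "distinct p"
proof (rule ccontr)
  assume "\<not> distinct p"
  then obtain xs ys zs c where p_eq: "p = xs @ [c] @ ys @ [c] @ zs"
    using not_distinct_decomp by blast
  have "awalk (tail \<Gamma> c) (c # ys) (tail \<Gamma> c)"
    using p(1) unfolding p_eq by (auto simp: awalk_Cons_iff)
  moreover have "set (c # ys) \<subseteq> S" using p(2) p_eq by auto
  ultimately have "reduce rv (c # ys) = []"
    using invariant_subgraph_no_loop[OF S] by blast
  moreover have "reduced rv (c # ys)"
    using p(3) unfolding p_eq reduced_def by (auto simp: successively_append_iff successively_Cons)
  ultimately show False by (simp add: reduce_id)
qed

lemma invariant_subgraph_path_length:
  assumes "S \<subset> arcs \<Gamma>" "rv ` S \<subseteq> S" "i > 0" "\<And>e. e \<in> S \<Longrightarrow> set (gk i [e]) \<subseteq> S"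
    and "awalk u p v" "set p \<subseteq> S" "reduced rv p"
  shows "length p \<le> card (arcs \<Gamma>)"
proof -
  have "length p = card (set p)"
    using invariant_subgraph_path_distinct[OF assms] by (simp add: distinct_card)
  also have "\<dots> \<le> card (arcs \<Gamma>)"
    using assms(1,6) by (intro card_mono) auto
  finally show ?thesis .
qed

section \<open>Growing edges\<close>

text \<open>The images of the edge under the iterates of \<open>g\<close> have unbounded length.\<close>

definition growing :: "'e \<Rightarrow> bool" where
  "growing e \<longleftrightarrow> e \<in> arcs \<Gamma> \<and> (\<forall>C. \<exists>k. length (gk k [e]) > C)"

lemma awalk_gk_arc: "e \<in> arcs \<Gamma> \<Longrightarrow> awalk (gv k (tail \<Gamma> e)) (gk k [e]) (gv k (head \<Gamma> e))"
  by (rule awalk_gk[OF arc_implies_awalk])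

lemma gk_arc_arcs: "e \<in> arcs \<Gamma> \<Longrightarrow> set (gk k [e]) \<subseteq> arcs \<Gamma>"
  by (rule gk_arcs) simp

text \<open>
  If no edge grew, then only finitely many maps would occur among the iterates of \<open>g\<close>, so some power of \<open>g\<close> would act
  trivially on the loops at a periodic vertex. Then a power of \<open>\<phi>\<close> would be trivial, and the identity
  preserves the cyclic free factor of the first generator, which is proper in rank at least two.
\<close>

lemma ex_growing: "\<exists>e. growing e"
proof (rule ccontr)
  assume "\<nexists>e. growing e"
  then have "\<forall>e\<in>arcs \<Gamma>. \<exists>C. \<forall>k. length (gk k [e]) \<le> C"
    by (auto simp: growing_def not_less)
  then obtain C where C: "\<And>e k. e \<in> arcs \<Gamma> \<Longrightarrow> length (gk k [e]) \<le> C e" by metis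
  define M where "M = (\<Sum>e\<in>arcs \<Gamma>. C e)"
  have M: "length (gk k [e]) \<le> M" if "e \<in> arcs \<Gamma>" for e k
    using C[OF that, of k] member_le_sum[OF that, of C] by (simp add: M_def)
  have v0: "vmap m () \<in> verts \<Gamma>"
    using marked by (auto simp: marked_graph_def homotopy_equiv_def is_graph_map_def rose_def)
  let ?f = "\<lambda>k. (\<lambda>e\<in>arcs \<Gamma>. gk k [e], gv k (vmap m ()))"
  let ?A = "(arcs \<Gamma> \<rightarrow>\<^sub>E {p. set p \<subseteq> arcs \<Gamma> \<and> length p \<le> M}) \<times> verts \<Gamma>"
  have "?f k \<in> ?A" for k
    using gk_arc_arcs M gv_verts[OF v0] by auto
  moreover have "finite ?A"
    by (intro finite_cartesian_product finite_PiE finite_lists_length_le) auto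
  ultimately obtain j n where n: "n > 0" "?f (j + n) = ?f j"
    using eventually_periodic[of ?A ?f] by blast
  let ?w = "gv j (vmap m ())"
  have w_fix: "gv n ?w = ?w"
  proof -
    have "gv n ?w = gv (j + n) (vmap m ())" by (simp only: add.commute[of j] funpow_add comp_apply)
    then show ?thesis using n(2) by simp
  qed
  have arc: "gk (j + n) [e] = gk j [e]" if "e \<in> arcs \<Gamma>" for e
    using fun_cong[OF arg_cong[OF n(2), of fst], of e] that by simp
  have path: "gk (j + n) p = gk j p" if "set p \<subseteq> arcs \<Gamma>" for p
    using that
  proof (induction p)
    case (Cons e p)
    then show ?case using gk_append[of "j + n" "[e]" p] gk_append[of j "[e]" p] arc[of e] by simp
  qed simp
  have loop: "homotopic rv (gk n p) p" if p: "awalk ?w p ?w" for p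
  proof -
    have "awalk ?w (gk n p @ path_inv rv p) ?w"
      using awalk_gk[OF p, of n] awalk_path_inv[OF p] w_fix by (auto intro: awalk_appendI)
    moreover have "gk j (gk n p @ path_inv rv p) = gk j p @ path_inv rv (gk j p)"
      using p path[of p] by (simp add: gk_append gk_path_inv awalk_def gk_add)
    then have "reduce rv (gk j (gk n p @ path_inv rv p)) = []"
      by (simp add: reduce_path_inv_right)
    ultimately have "homotopic rv (gk n p @ path_inv rv p) (p @ path_inv rv p)"
      using gk_inj by (simp add: reduce_path_inv_right)
    then show ?thesis by (rule homotopic_cancel_right)
  qed
  have w: "?w \<in> verts \<Gamma>" using v0 by (rule gv_verts)
  obtain \<theta> \<Psi> where based: "based_marking \<Gamma> rv F r ?w \<theta>" and \<Psi>: "\<Psi> \<in> \<phi> [^]\<^bsub>Out F\<^esub> n"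
    and act: "\<And>x. x \<in> carrier F \<Longrightarrow> homotopic rv (\<theta> (\<Psi> x)) (gk n (\<theta> x))"
    by (rule fixed_vertex_action[OF w w_fix]) blast
  interpret B: based_marking \<Gamma> rv F r ?w \<theta> by (rule based)
  have \<Psi>_id: "\<Psi> x = x" if x: "x \<in> carrier F" for x
  proof (rule B.\<theta>_eq)
    show "\<Psi> x \<in> carrier F"
      using F.mem_Out(1)[OF \<phi>_pow \<Psi>] x by (auto simp: auto_def intro: hom_in_carrier)
    show "homotopic rv (\<theta> (\<Psi> x)) (\<theta> x)"
      using act[OF x] loop[OF B.\<theta>_loop[OF x]] by simp
  qed (rule x)
  let ?Y = "{0} \<times> (UNIV :: bool set)"
  interpret L: free_basis F letter_inv "letters r" "\<lambda>w. w" by (rule free_basis_free_group)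
  have "reducible F (\<phi> [^]\<^bsub>Out F\<^esub> n)"
  proof (rule reducible_of_invariant_span[OF free_basis_free_group \<phi>_pow \<Psi>])
    have "(1, True) \<in> letters r - ?Y" "?Y \<subseteq> letters r" using r by (auto simp: letters_def)
    then show "?Y \<subset> letters r" by blast
    show "\<Psi> ` L.span ?Y \<subseteq> L.span ?Y"
      using \<Psi>_id by (auto simp: L.span_def)
  qed (auto simp: letter_inv_def)
  then show False using not_reducible[OF n(1)] by simp
qed

text \<open>An edge occurs in a path if the path crosses it in either direction.\<close>

definition occurs :: "'e \<Rightarrow> 'e list \<Rightarrow> bool" where
  "occurs a p \<longleftrightarrow> a \<in> set p \<or> rv a \<in> set p"

lemma occurs_gk:
  assumes "occurs e p" "occurs a (gk k [e])" "set p \<subseteq> arcs \<Gamma>"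
  shows "occurs a (gk k p)"
proof -
  from assms(1) obtain e' where e': "e' \<in> set p" "e' = e \<or> e' = rv e" by (auto simp: occurs_def)
  then have "e' \<in> arcs \<Gamma>" using assms(3) by auto
  then have "occurs a (gk k [e'])"
    using assms(2) e'(2) gk_path_inv[of "[e']" k]
    by (auto simp: occurs_def path_inv_def image_iff arev_eq_iff)
  then show ?thesis
    using e'(1) unfolding occurs_def set_gk[of k p] by blast
qed

lemma length_gk: "length (gk k p) = (\<Sum>e\<leftarrow>p. length (gk k [e]))"
proof (induction p)
  case (Cons e p)
  then show ?case using gk_append[of k "[e]" p] by simp
qed simp

text \<open>
  The edges crossed by the images of \<open>b\<close> under the iterates of \<open>g\<^sup>i\<close> form an invariant subgraph. It is not a proper one, since
  reduced paths in a forest have bounded length.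
\<close>

lemma growing_orbit:
  assumes b: "growing b" and i: "i > 0" and a: "a \<in> arcs \<Gamma>"
  shows "\<exists>k>0. occurs a (gk (i * k) [b])"
proof (rule ccontr)
  assume not: "\<not> ?thesis"
  have b': "b \<in> arcs \<Gamma>" using b by (simp add: growing_def)
  define S where "S = {e. \<exists>k>0. occurs e (gk (i * k) [b])}"
  have rv_S: "rv ` S \<subseteq> S" by (auto simp: S_def occurs_def)
  have "e \<in> arcs \<Gamma>" if "e \<in> S" for e
  proof -
    from that obtain k where "e \<in> set (gk (i * k) [b]) \<or> rv e \<in> set (gk (i * k) [b])"
      by (auto simp: S_def occurs_def)
    then have "e \<in> arcs \<Gamma> \<or> rv e \<in> arcs \<Gamma>" using gk_arc_arcs[OF b'] by blast
    then show ?thesis using arev_in_arcs[of "rv e"] by auto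
  qed
  moreover have "a \<notin> S" using not by (simp add: S_def)
  ultimately have S: "S \<subset> arcs \<Gamma>" using a by auto
  have inv: "set (gk i [e]) \<subseteq> S" if "e \<in> S" for e
  proof
    fix f assume f: "f \<in> set (gk i [e])"
    from that obtain k where k: "occurs e (gk (i * k) [b])" unfolding S_def by blast
    have "occurs f (gk i [e])" using f by (simp add: occurs_def)
    then have "occurs f (gk i (gk (i * k) [b]))"
      by (rule occurs_gk[OF k _ gk_arc_arcs[OF b']])
    then have "occurs f (gk (i * Suc k) [b])" by (simp add: gk_add)
    then show "f \<in> S" unfolding S_def by blast
  qed
  have bound: "length (gk (i * k) [b]) \<le> Suc (card (arcs \<Gamma>))" for k
  proof (cases "k = 0")
    case False
    have *: "set (gk (i * k) [b]) \<subseteq> S" using False by (auto simp: S_def occurs_def)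
    have "length (gk (i * k) [b]) \<le> card (arcs \<Gamma>)"
      by (rule invariant_subgraph_path_length[OF S rv_S i inv awalk_gk_arc[OF b'] * gk_reduced[OF b']])
    then show ?thesis by simp
  qed simp
  define L where "L = (\<Sum>l<i. \<Sum>e\<in>arcs \<Gamma>. length (gk l [e]))"
  have L: "length (gk l [e]) \<le> L" if "l < i" "e \<in> arcs \<Gamma>" for l e
  proof -
    have "length (gk l [e]) \<le> (\<Sum>e\<in>arcs \<Gamma>. length (gk l [e]))"
      using that by (intro member_le_sum) auto
    also have "\<dots> \<le> L" unfolding L_def
      using that by (intro member_le_sum[of l "{..<i}" "\<lambda>l. \<Sum>e\<in>arcs \<Gamma>. length (gk l [e])"]) auto
    finally show ?thesis .
  qed
  have "length (gk j [b]) \<le> Suc (card (arcs \<Gamma>)) * L" for j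
  proof -
    let ?p = "gk (i * (j div i)) [b]"
    have "gk j [b] = gk (j mod i) ?p" using gk_add[of "j mod i" "i * (j div i)" "[b]"] by simp
    then have "length (gk j [b]) = (\<Sum>e\<leftarrow>?p. length (gk (j mod i) [e]))"
      using length_gk[of "j mod i" ?p] by (simp only:)
    also have "\<dots> \<le> (\<Sum>e\<leftarrow>?p. L)"
      using L[of "j mod i"] i gk_arc_arcs[OF b'] by (intro sum_list_mono) auto
    also have "\<dots> \<le> Suc (card (arcs \<Gamma>)) * L"
      using mult_le_mono1[OF bound[of "j div i"], of L] by (simp add: sum_list_triv)
    finally show ?thesis .
  qed
  then show False using b unfolding growing_def by (meson not_less)
qed

text \<open>
  The transition matrix of \<open>g\<close> need not be irreducible, because there may be invariant forests; but every
  sufficiently high iterate maps a growing edge \<open>b\<close> over the whole graph. Indeed \<open>b\<close> occurs in some \<open>g\<^sup>i(b)\<close>, so the sets of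
  edges crossed by \<open>g\<^bsup>ik\<^esup>(b)\<close> increase with \<open>k\<close>, up to the whole graph; and \<open>g\<close> maps the whole graph over itself.
\<close>

lemma growing_covers:
  assumes b: "growing b"
  obtains n0 where "\<And>n a. n \<ge> n0 \<Longrightarrow> a \<in> arcs \<Gamma> \<Longrightarrow> occurs a (gk n [b])"
proof -
  have b': "b \<in> arcs \<Gamma>" using b by (simp add: growing_def)
  obtain i where i: "i > 0" "occurs b (gk i [b])"
    using growing_orbit[OF b, of 1 b] b' by auto
  have mono1: "occurs a (gk (i * Suc k) [b])" if "occurs a (gk (i * k) [b])" for a k
  proof -
    have "occurs a (gk (i * k) (gk i [b]))"
      using occurs_gk[OF i(2) that gk_arc_arcs[OF b']] .
    moreover have "gk (i * k) (gk i [b]) = gk (i * Suc k) [b]"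
      using gk_add[of "i * k" i "[b]"] by (simp add: add.commute)
    ultimately show ?thesis by simp
  qed
  have mono: "occurs a (gk (i * l) [b])" if "k \<le> l" "occurs a (gk (i * k) [b])" for a k l
    using that
  proof (induction rule: dec_induct)
    case (step n)
    from mono1[OF step.IH[OF step.prems]] show ?case .
  qed
  have "\<forall>a\<in>arcs \<Gamma>. \<exists>k. occurs a (gk (i * k) [b])" using growing_orbit[OF b i(1)] by blast
  then obtain K where K: "\<And>a. a \<in> arcs \<Gamma> \<Longrightarrow> occurs a (gk (i * K a) [b])" by metis
  define n0 where "n0 = i * (\<Sum>a\<in>arcs \<Gamma>. K a)"
  have "occurs a (gk n [b])" if "n0 \<le> n" "a \<in> arcs \<Gamma>" for n a
    using that
  proof (induction arbitrary: a rule: dec_induct)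
    case base
    then show ?case unfolding n0_def
      using mono[OF member_le_sum[of a "arcs \<Gamma>" K] K] by auto
  next
    case (step n)
    obtain j where j: "j > 0" "occurs a (gk (1 * j) [b])" using growing_orbit[OF b, of 1 a] step.prems by auto
    then obtain j' where "j = Suc j'" by (cases j) auto
    then have "occurs a (gk 1 (gk j' [b]))" using j(2) by simp
    then obtain e where e: "e \<in> set (gk j' [b])" "occurs a (gk 1 [e])"
      unfolding occurs_def set_gk[of 1 "gk j' [b]"] by blast
    have "occurs e (gk n [b])" using step.IH gk_arc_arcs[OF b'] e(1) by blast
    then have "occurs a (gk 1 (gk n [b]))" using e(2) gk_arc_arcs[OF b'] by (rule occurs_gk)
    then show ?case by simp
  qed
  then show thesis using that by blast
qed

lemma growing_rv: assumes "growing e" shows "growing (rv e)"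
proof -
  have e: "e \<in> arcs \<Gamma>" using assms by (simp add: growing_def)
  have "gk k [rv e] = path_inv rv (gk k [e])" for k
    using gk_path_inv[of "[e]" k] e by (simp add: path_inv_def)
  then show ?thesis using assms by (simp add: growing_def path_inv_def)
qed

text \<open>
  The edges that do not grow form a forest, which bounds the length of the segments between growing edges. So the number of
  growing edges in the iterated images of a growing edge is unbounded, and one of them is repeated.
\<close>

lemma growing_repeats:
  assumes b: "growing b"
  obtains k c p q s where "k > 0" "growing c" "gk k [b] = p @ c # q @ c # s"
proof -
  have b': "b \<in> arcs \<Gamma>" using b by (simp add: growing_def)
  define S where "S = {e \<in> arcs \<Gamma>. \<not> growing e}"
  have S: "S \<subset> arcs \<Gamma>" using b b' by (auto simp: S_def)
  have rv_S: "rv ` S \<subseteq> S" using growing_rv by (force simp: S_def)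
  have inv: "set (gk 1 [e]) \<subseteq> S" if e: "e \<in> S" for e
  proof
    fix a assume a: "a \<in> set (gk 1 [e])"
    have "length (gk k [a]) \<le> length (gk (Suc k) [e])" for k
    proof -
      have "length (gk k [a]) \<le> length (gk k (gk 1 [e]))"
        unfolding length_gk[of k "gk 1 [e]"] using a by (intro member_le_sum_list) auto
      then show ?thesis by (simp add: funpow_swap1)
    qed
    moreover obtain C where "\<And>k. length (gk k [e]) \<le> C"
      using e by (auto simp: S_def growing_def not_less)
    ultimately have "length (gk k [a]) \<le> C" for k by (meson le_trans)
    then have "\<not> growing a" by (auto simp: growing_def not_less)
    then show "a \<in> S" using a e gk_arc_arcs[of e 1] by (auto simp: S_def)
  qed
  let ?C = "card (arcs \<Gamma>)"
  obtain k where k: "length (gk k [b]) > Suc ?C * Suc ?C" using b by (auto simp: growing_def)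
  let ?p = "gk k [b]"
  have "Suc ?C \<le> length (filter growing ?p)"
  proof (rule filter_length_ge_blocks[where L = "Suc ?C"])
    fix u v z assume p: "?p = u @ v @ z" "length v = Suc ?C"
    obtain x y where xy: "awalk x v y"
      using awalk_gk_arc[OF b', of k] unfolding p(1) by (auto simp: awalk_append_iff)
    have red: "reduced rv v"
      using gk_reduced[OF b', of k] unfolding p(1) by (simp add: reduced_def successively_append_iff)
    show "\<exists>e\<in>set v. growing e"
    proof (rule ccontr)
      assume "\<not> (\<exists>e\<in>set v. growing e)"
      then have "set v \<subseteq> S" using xy by (auto simp: S_def awalk_def)
      then have "length v \<le> ?C"
        using invariant_subgraph_path_length[OF S rv_S zero_less_one inv xy _ red] by blast
      then show False using p(2) by simp
    qed
  qed (use k in auto)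
  moreover have "length (filter growing ?p) \<le> ?C" if "distinct (filter growing ?p)"
  proof -
    have "card (set (filter growing ?p)) \<le> ?C"
      using gk_arc_arcs[OF b', of k] by (intro card_mono) auto
    then show ?thesis using distinct_card[OF that] by simp
  qed
  ultimately have "\<not> distinct (filter growing ?p)" by auto
  then obtain c u v z where "growing c" "?p = u @ c # v @ c # z"
    by (rule not_distinct_filter_decomp)
  moreover have "k > 0" using k by (cases k) auto
  ultimately show thesis using that by blast
qed

end

section \<open>Periodic smooth lines\<close>

text \<open>A periodic bi-infinite sequence takes each of its values infinitely often in both directions.\<close>

lemma infinite_recurrence:
  fixes c :: "int \<Rightarrow> 'x"
  assumes per: "\<And>i. c (i + P) = c i" and P: "P > 0"
  shows "infinite {i. i \<ge> 0 \<and> c i = c i0}" "infinite {i. i \<le> 0 \<and> c i = c i0}"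
proof -
  have pos: "c (i + P * int k) = c i" for i k
  proof (induction k)
    case (Suc k)
    then show ?case using per[of "i + P * int k"] by (simp add: algebra_simps)
  qed simp
  have neg: "c (i - P * int k) = c i" for i k
    using pos[of "i - P * int k" k] by simp
  have inj: "inj (\<lambda>k::nat. i0 + P * int (k + nat \<bar>i0\<bar>))" "inj (\<lambda>k::nat. i0 - P * int (k + nat \<bar>i0\<bar>))"
    using P by (auto simp: inj_def)
  have large: "P * int (k + nat \<bar>i0\<bar>) \<ge> \<bar>i0\<bar>" for k :: nat
  proof -
    have "1 * \<bar>i0\<bar> \<le> P * int (k + nat \<bar>i0\<bar>)" using P by (intro mult_mono) auto
    then show ?thesis by simp
  qed
  have "range (\<lambda>k::nat. i0 + P * int (k + nat \<bar>i0\<bar>)) \<subseteq> {i. i \<ge> 0 \<and> c i = c i0}"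
  proof safe
    fix k :: nat
    show "0 \<le> i0 + P * int (k + nat \<bar>i0\<bar>)" using large[of k] by linarith
  qed (rule pos)
  then show "infinite {i. i \<ge> 0 \<and> c i = c i0}"
    using range_inj_infinite[OF inj(1)] by (rule infinite_super)
  have "range (\<lambda>k::nat. i0 - P * int (k + nat \<bar>i0\<bar>)) \<subseteq> {i. i \<le> 0 \<and> c i = c i0}"
  proof safe
    fix k :: nat
    show "i0 - P * int (k + nat \<bar>i0\<bar>) \<le> 0" using large[of k] by linarith
  qed (rule neg)
  then show "infinite {i. i \<le> 0 \<and> c i = c i0}"
    using range_inj_infinite[OF inj(2)] by (rule infinite_super)
qed

lemma split_consecutive:
  "Suc i < length l \<Longrightarrow> l = take i l @ l ! i # l ! Suc i # drop (Suc (Suc i)) l"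
  by (simp add: Cons_nth_drop_Suc)

lemma turn_colour_cong:
  assumes "{d\<^sub>1, d\<^sub>2} = {d\<^sub>1', d\<^sub>2'}" shows "turn_colour g d\<^sub>1 d\<^sub>2 = turn_colour g d\<^sub>1' d\<^sub>2'"
  using assms by (auto simp: turn_colour_def doubleton_eq_iff)

lemma turn_colour_not_Black: "turn_colour g d\<^sub>1 d\<^sub>2 \<noteq> Black"
  by (simp add: turn_colour_def)

context train_track begin

text \<open>The turns that are coloured edges of the LTT structure.\<close>

definition taken :: "'e \<Rightarrow> 'e \<Rightarrow> bool" where
  "taken d\<^sub>1 d\<^sub>2 \<longleftrightarrow> (\<exists>k::nat. k > 0 \<and> (\<exists>e\<in>arcs \<Gamma>. takes_turn rv (gk k [e]) d\<^sub>1 d\<^sub>2))"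

text \<open>
  A cyclic word \<open>w\<close> of oriented edges whose cyclically consecutive letters form taken turns, and in which all edges
  and all taken turns occur, is spelled periodically by a smooth line: even positions cross the edges of \<open>w\<close>
  and odd positions cross the turns between them.
\<close>

lemma birecurrent_of_cyclic_word:
  fixes w :: "'e list"
  defines "n \<equiv> length w"
  assumes n: "n > 0" and w: "set w \<subseteq> arcs \<Gamma>"
    and turn: "\<And>i. i < n \<Longrightarrow> taken (rv (w ! i)) (w ! (Suc i mod n)) \<and> head \<Gamma> (w ! i) = tail \<Gamma> (w ! (Suc i mod n))"
    and all_edges: "\<And>a. a \<in> arcs \<Gamma> \<Longrightarrow> occurs a w"
    and all_turns: "\<And>d\<^sub>1 d\<^sub>2. d\<^sub>1 \<in> arcs \<Gamma> \<Longrightarrow> d\<^sub>2 \<in> arcs \<Gamma> \<Longrightarrow> taken d\<^sub>1 d\<^sub>2 \<Longrightarrow> takes_turn rv w d\<^sub>1 d\<^sub>2"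
  shows "birecurrent (LTT \<Gamma> rv g)"
proof -
  define a where "a j = w ! nat (j mod int n)" for j :: int
  define x where "x i = (if even i then a (i div 2) else rv (a (i div 2)))" for i :: int
  define c where "c i = (if even i then (Black, {a (i div 2), rv (a (i div 2))})
    else (turn_colour g (rv (a (i div 2))) (a (i div 2 + 1)), {rv (a (i div 2)), a (i div 2 + 1)}))" for i :: int
  have a_nat: "a (int j) = w ! j" if "j < n" for j
    using that by (simp add: a_def)
  have a_cases: "\<exists>i<n. a j = w ! i \<and> a (j + 1) = w ! (Suc i mod n)" for j
  proof -
    let ?i = "nat (j mod int n)"
    have "int ?i = j mod int n" using n by simp
    moreover have "(j + 1) mod int n = (j mod int n + 1) mod int n" by (simp add: mod_simps)
    ultimately have "(j + 1) mod int n = int (Suc ?i mod n)" by (simp add: zmod_int add.commute)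
    moreover have "?i < n" using n by (simp add: nat_less_iff)
    ultimately show ?thesis unfolding a_def by (intro exI[of _ ?i]) simp
  qed
  have a_arcs: "a j \<in> arcs \<Gamma>" for j
    using a_cases[of j] w nth_mem[of _ w] by (auto simp: n_def)
  have edges: "ltt_edges (LTT \<Gamma> rv g) = {(Black, {e, rv e}) | e. e \<in> arcs \<Gamma>} \<union>
      {(turn_colour g d\<^sub>1 d\<^sub>2, {d\<^sub>1, d\<^sub>2}) | d\<^sub>1 d\<^sub>2.
        d\<^sub>1 \<in> arcs \<Gamma> \<and> d\<^sub>2 \<in> arcs \<Gamma> \<and> tail \<Gamma> d\<^sub>1 = tail \<Gamma> d\<^sub>2 \<and> taken d\<^sub>1 d\<^sub>2}"
    by (simp add: LTT_def taken_def)
  have c_edge: "c i \<in> ltt_edges (LTT \<Gamma> rv g)" for i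
  proof (cases "even i")
    case True
    then show ?thesis using a_arcs unfolding edges c_def by auto
  next
    case False
    obtain k where k: "k < n" "a (i div 2) = w ! k" "a (i div 2 + 1) = w ! (Suc k mod n)"
      using a_cases by blast
    let ?d = "rv (a (i div 2))" and ?d' = "a (i div 2 + 1)"
    have "?d \<in> arcs \<Gamma> \<and> ?d' \<in> arcs \<Gamma> \<and> tail \<Gamma> ?d = tail \<Gamma> ?d' \<and> taken ?d ?d'"
      using turn[OF k(1)] a_arcs[of "i div 2"] a_arcs[of "i div 2 + 1"] by (simp add: k(2,3))
    then have "(turn_colour g ?d ?d', {?d, ?d'}) \<in> ltt_edges (LTT \<Gamma> rv g)" unfolding edges by blast
    then show ?thesis using False by (simp add: c_def)
  qed
  have smooth: "smooth_line (LTT \<Gamma> rv g) x c"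
    unfolding smooth_line_def
  proof (intro allI conjI)
    fix i :: int
    show "x i \<in> ltt_verts (LTT \<Gamma> rv g)" using a_arcs by (simp add: x_def LTT_def)
    show "c i \<in> ltt_edges (LTT \<Gamma> rv g)" by (rule c_edge)
    have "(i + 1) div 2 = (if even i then i div 2 else i div 2 + 1)" by presburger
    then show "snd (c i) = {x i, x (i + 1)}" by (auto simp: c_def x_def)
    show "fst (c (i + 1)) = Black \<longleftrightarrow> fst (c i) \<noteq> Black"
      by (auto simp: c_def turn_colour_not_Black)
  qed
  have a_period: "a (j + int n) = a j" for j by (simp add: a_def)
  have period: "c (i + 2 * int n) = c i" for i
  proof -
    have "(i + 2 * int n) div 2 = i div 2 + int n" "even (i + 2 * int n) = even i" by simp_all
    moreover have "a (i div 2 + int n + 1) = a (i div 2 + 1)"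
      using a_period[of "i div 2 + 1"] by (simp add: algebra_simps)
    ultimately show ?thesis by (simp only: c_def a_period)
  qed
  have hit: "\<exists>i0. c i0 = b" if b: "b \<in> ltt_edges (LTT \<Gamma> rv g)" for b
  proof -
    consider (edge) e where "e \<in> arcs \<Gamma>" "b = (Black, {e, rv e})"
      | (turn) d\<^sub>1 d\<^sub>2 where "d\<^sub>1 \<in> arcs \<Gamma>" "d\<^sub>2 \<in> arcs \<Gamma>" "taken d\<^sub>1 d\<^sub>2" "b = (turn_colour g d\<^sub>1 d\<^sub>2, {d\<^sub>1, d\<^sub>2})"
      using b unfolding edges by blast
    then show ?thesis
    proof cases
      case edge
      then obtain j where j: "j < n" "w ! j = e \<or> w ! j = rv e"
        using all_edges[of e] unfolding occurs_def n_def in_set_conv_nth by blast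
      have "c (2 * int j) = (Black, {w ! j, rv (w ! j)})" using j(1) by (simp add: c_def a_nat)
      also have "\<dots> = b" using j(2) edge(2) by auto
      finally show ?thesis by blast
    next
      case turn
      then obtain j where j: "Suc j < n" "{d\<^sub>1, d\<^sub>2} = {rv (w ! j), w ! Suc j}"
        using all_turns[of d\<^sub>1 d\<^sub>2] unfolding takes_turn_def n_def by blast
      have "a (int j + 1) = w ! Suc j" using a_nat[OF j(1)] by (simp add: add.commute)
      then have "c (2 * int j + 1) = (turn_colour g (rv (w ! j)) (w ! Suc j), {rv (w ! j), w ! Suc j})"
        using j(1) by (simp add: c_def a_nat)
      also have "\<dots> = b" using j(2) turn(4) turn_colour_cong[OF j(2), of g] by simp
      finally show ?thesis by blast
    qed
  qed
  show ?thesis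
    unfolding birecurrent_def
  proof (intro exI conjI ballI)
    show "smooth_line (LTT \<Gamma> rv g) x c" by (rule smooth)
    fix b assume "b \<in> ltt_edges (LTT \<Gamma> rv g)"
    then obtain i0 where i0: "b = c i0" using hit by metis
    show "infinite {i. i \<ge> 0 \<and> c i = b}" "infinite {i. i \<le> 0 \<and> c i = b}"
      unfolding i0 using infinite_recurrence[of c "2 * int n" i0, OF period] n by simp_all
  qed
qed

lemma takes_turn_infix:
  assumes "takes_turn rv p d\<^sub>1 d\<^sub>2" shows "takes_turn rv (u @ p @ v) d\<^sub>1 d\<^sub>2"
proof -
  from assms obtain i where i: "Suc i < length p" "{d\<^sub>1, d\<^sub>2} = {rv (p ! i), p ! Suc i}"
    by (auto simp: takes_turn_def)
  then show ?thesis
    unfolding takes_turn_def by (intro exI[of _ "length u + i"]) (simp add: nth_append)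
qed

lemma takes_turn_path_inv:
  assumes "takes_turn rv p d\<^sub>1 d\<^sub>2" shows "takes_turn rv (path_inv rv p) d\<^sub>1 d\<^sub>2"
proof -
  from assms obtain i where i: "Suc i < length p" "{d\<^sub>1, d\<^sub>2} = {rv (p ! i), p ! Suc i}"
    by (auto simp: takes_turn_def)
  let ?j = "length p - Suc (Suc i)"
  have j: "Suc ?j < length p" using i(1) by simp
  have "path_inv rv p ! ?j = rv (p ! Suc i)" "path_inv rv p ! Suc ?j = rv (p ! i)"
    using i(1) j by (simp_all add: path_inv_def rev_nth Suc_diff_Suc)
  then show ?thesis
    unfolding takes_turn_def using j i(2) by (intro exI[of _ ?j]) (auto simp: path_inv_def)
qed

lemma takes_turn_gk:
  assumes "takes_turn rv (gk k [e]) d\<^sub>1 d\<^sub>2" "occurs e p" "set p \<subseteq> arcs \<Gamma>"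
  shows "takes_turn rv (gk k p) d\<^sub>1 d\<^sub>2"
proof -
  from assms(2) obtain e' where e': "e' \<in> set p" "e = e' \<or> e = rv e'" by (auto simp: occurs_def)
  then have "gk k [rv e'] = path_inv rv (gk k [e'])"
    using gk_path_inv[of "[e']" k] assms(3) by (auto simp: path_inv_def)
  then have "takes_turn rv (gk k [e']) d\<^sub>1 d\<^sub>2"
    using assms(1) e'(2) takes_turn_path_inv[of "gk k [rv e']" d\<^sub>1 d\<^sub>2] by fastforce
  moreover obtain u v where "p = u @ [e'] @ v" using split_list[OF e'(1)] by auto
  then have "gk k p = gk k u @ gk k [e'] @ gk k v" by (simp only: gk_append)
  ultimately show ?thesis using takes_turn_infix[of "gk k [e']"] by (simp only:)
qed

text \<open>
  Since high iterates of \<open>c\<close> cross every edge, they also take every turn that is taken at all; a common exponent exists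
  because there are finitely many turns.
\<close>

lemma growing_covers_turns:
  assumes c: "growing c"
  shows "\<exists>M. (\<forall>a\<in>arcs \<Gamma>. occurs a (gk M [c])) \<and>
    (\<forall>d\<^sub>1\<in>arcs \<Gamma>. \<forall>d\<^sub>2\<in>arcs \<Gamma>. taken d\<^sub>1 d\<^sub>2 \<longrightarrow> takes_turn rv (gk M [c]) d\<^sub>1 d\<^sub>2)"
proof -
  have c': "c \<in> arcs \<Gamma>" using c by (simp add: growing_def)
  obtain n0 where n0: "\<And>n a. n \<ge> n0 \<Longrightarrow> a \<in> arcs \<Gamma> \<Longrightarrow> occurs a (gk n [c])"
    using growing_covers[OF c] by blast
  let ?T = "{(d\<^sub>1, d\<^sub>2). d\<^sub>1 \<in> arcs \<Gamma> \<and> d\<^sub>2 \<in> arcs \<Gamma> \<and> taken d\<^sub>1 d\<^sub>2}"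
  have fin: "finite ?T" by (rule finite_subset[of _ "arcs \<Gamma> \<times> arcs \<Gamma>"]) auto
  have "\<forall>t\<in>?T. \<exists>k. \<exists>e\<in>arcs \<Gamma>. takes_turn rv (gk k [e]) (fst t) (snd t)"
    unfolding taken_def by auto
  from bchoice[OF this] obtain K
    where K: "\<forall>t\<in>?T. \<exists>e\<in>arcs \<Gamma>. takes_turn rv (gk (K t) [e]) (fst t) (snd t)" ..
  define M where "M = n0 + (\<Sum>t\<in>?T. K t)"
  show ?thesis
  proof (intro exI[of _ M] conjI ballI impI)
    show "occurs a (gk M [c])" if "a \<in> arcs \<Gamma>" for a using n0 that by (simp add: M_def)
    fix d\<^sub>1 d\<^sub>2 assume "d\<^sub>1 \<in> arcs \<Gamma>" "d\<^sub>2 \<in> arcs \<Gamma>" "taken d\<^sub>1 d\<^sub>2"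
    then have t: "(d\<^sub>1, d\<^sub>2) \<in> ?T" by simp
    let ?k = "K (d\<^sub>1, d\<^sub>2)"
    have k: "?k + n0 \<le> M" using member_le_sum[OF t, of K] fin by (simp add: M_def)
    from bspec[OF K t] obtain e where e: "e \<in> arcs \<Gamma>" "takes_turn rv (gk ?k [e]) d\<^sub>1 d\<^sub>2"
      unfolding fst_conv snd_conv by blast
    have "occurs e (gk (M - ?k) [c])" using k e(1) by (intro n0) auto
    then have "takes_turn rv (gk ?k (gk (M - ?k) [c])) d\<^sub>1 d\<^sub>2"
      by (rule takes_turn_gk[OF e(2) _ gk_arc_arcs[OF c']])
    then show "takes_turn rv (gk M [c]) d\<^sub>1 d\<^sub>2"
      using k by (simp flip: gk_add)
  qed
qed

text \<open>
  The segment \<open>c q\<close> of \<open>g\<^sup>k(b)\<close> between two occurrences of \<open>c\<close> closes up to a cyclic word with taken turns only. So does its image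
  under \<open>g\<^sup>M\<close>, which contains \<open>g\<^sup>M(c)\<close> and hence every edge and every taken turn.
\<close>

lemma birecurrent_LTT: "birecurrent (LTT \<Gamma> rv g)"
proof -
  obtain b where b: "growing b" using ex_growing by blast
  obtain k c p q s where k: "k > 0" "growing c" "gk k [b] = p @ c # q @ c # s"
    by (rule growing_repeats[OF b])
  obtain M where M: "\<forall>a\<in>arcs \<Gamma>. occurs a (gk M [c])"
    "\<forall>d\<^sub>1\<in>arcs \<Gamma>. \<forall>d\<^sub>2\<in>arcs \<Gamma>. taken d\<^sub>1 d\<^sub>2 \<longrightarrow> takes_turn rv (gk M [c]) d\<^sub>1 d\<^sub>2"
    using growing_covers_turns[OF k(2)] by blast
  have b': "b \<in> arcs \<Gamma>" and c': "c \<in> arcs \<Gamma>" using b k(2) by (simp_all add: growing_def)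
  define w where "w = gk M (c # q)"
  let ?n = "length w" and ?N = "M + k"
  have w: "w = gk M [c] @ gk M q" using gk_append[of M "[c]" q] by (simp add: w_def)
  have ne: "gk M [c] \<noteq> []" using M(1) c' by (auto simp: occurs_def)
  have "gk ?N [b] = gk M (p @ (c # q) @ [c] @ s)" by (simp add: gk_add k(3))
  then have "gk ?N [b] = gk M p @ w @ gk M [c] @ gk M s" by (simp only: gk_append w_def)
  (* The second occurrence of c supplies the turn that closes the cycle. *)
  moreover obtain t where "gk M [c] = hd w # t" using ne by (cases "gk M [c]") (auto simp: w)
  ultimately have long: "gk ?N [b] = gk M p @ (w @ [hd w]) @ t @ gk M s" by simp
  have n: "?n > 0" using ne by (simp add: w)
  have w_arcs: "set w \<subseteq> arcs \<Gamma>" using gk_arc_arcs[OF b', of ?N] unfolding long by simp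
  have cyc: "(w @ [hd w]) ! Suc i = w ! (Suc i mod ?n)" if "i < ?n" for i
    using that n by (cases "Suc i = ?n") (auto simp: nth_append hd_conv_nth)
  show ?thesis
  proof (rule birecurrent_of_cyclic_word[of w])
    show "0 < ?n" "set w \<subseteq> arcs \<Gamma>" by (rule n, rule w_arcs)
    fix i assume i: "i < ?n"
    have pair: "takes_turn rv (w @ [hd w]) (rv (w ! i)) (w ! (Suc i mod ?n))"
      unfolding takes_turn_def using i cyc[OF i] by (intro exI[of _ i]) (simp add: nth_append)
    then have "takes_turn rv (gk ?N [b]) (rv (w ! i)) (w ! (Suc i mod ?n))"
      unfolding long by (rule takes_turn_infix)
    then have taken: "taken (rv (w ! i)) (w ! (Suc i mod ?n))"
      unfolding taken_def using k(1) b' by (intro exI[of _ ?N]) auto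
    let ?l = "w @ [hd w]"
    have "?l = take i ?l @ ?l ! i # ?l ! Suc i # drop (Suc (Suc i)) ?l"
      using i by (intro split_consecutive) simp
    moreover have "?l ! i = w ! i" using i by (simp add: nth_append)
    ultimately have "?l = take i ?l @ w ! i # w ! (Suc i mod ?n) # drop (Suc (Suc i)) ?l"
      using cyc[OF i] by (simp only:)
    then obtain u v where "?l = u @ w ! i # w ! (Suc i mod ?n) # v" by blast
    then have "awalk (gv ?N (tail \<Gamma> b)) (gk M p @ (u @ w ! i # w ! (Suc i mod ?n) # v) @ t @ gk M s)
        (gv ?N (head \<Gamma> b))"
      using awalk_gk_arc[OF b', of ?N] unfolding long by simp
    then have "head \<Gamma> (w ! i) = tail \<Gamma> (w ! (Suc i mod ?n))"
      by (auto simp: awalk_Cons_iff)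
    with taken show "taken (rv (w ! i)) (w ! (Suc i mod ?n)) \<and> head \<Gamma> (w ! i) = tail \<Gamma> (w ! (Suc i mod ?n))"
      by blast
  next
    show "occurs a w" if "a \<in> arcs \<Gamma>" for a
      using M(1) that by (auto simp: w occurs_def)
    show "takes_turn rv w d\<^sub>1 d\<^sub>2" if "d\<^sub>1 \<in> arcs \<Gamma>" "d\<^sub>2 \<in> arcs \<Gamma>" "taken d\<^sub>1 d\<^sub>2" for d\<^sub>1 d\<^sub>2
      using takes_turn_infix[of "gk M [c]" d\<^sub>1 d\<^sub>2 "[]" "gk M q"] M(2) that by (simp add: w)
  qed
qed

end

theorem proposition1p7:
  fixes r :: nat
    and \<Gamma> :: "('v, 'e) pre_digraph"
    and rv :: "'e \<Rightarrow> 'e"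
    and m :: "(unit, letter, 'v, 'e) graph_map"
    and g :: "('v, 'e, 'v, 'e) graph_map"
    and \<phi> :: "(letter list \<Rightarrow> letter list) set"
  assumes "r \<ge> 2"
    and "\<phi> \<in> carrier (Out (free_group r))"
    and "fully_irreducible (free_group r) \<phi>"
    and "marked_graph r \<Gamma> rv m"
    and "train_track_rep r \<Gamma> rv m g \<phi>"
  shows "birecurrent (LTT \<Gamma> rv g)"
proof -
  interpret train_track r \<Gamma> rv m g \<phi>
    by unfold_locales (rule assms)+
  show ?thesis by (rule birecurrent_LTT)
qed

end
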